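(* Let $(X,f)$ be a $\lambda$-ergodic interval exchange transformation on $X=[0,b)$, where $\lambda$ is Lebesgue measure. Then the set $$X_{\mathrm{wm}}=\{\,0<t<b \mid f_t \text{ is weakly mixing relative to } \lambda\,\}$$ is a residual subset of $X$ of full Lebesgue measure, i.e. $\lambda(X_{\mathrm{wm}})=b$.
   Context: An interval exchange transformation (IET) is a pair $(X,f)$ where $X=[0,b)\subset\mathbb{R}$ is a bounded interval ($b>0$) and $f\colon X\to X$ is a right continuous bijection with a finite set $D$ of discontinuities such that $f'(x)=1$ for all $x\in X\setminus D$ (so $f$ is a local translation at each continuity point). Write $\#(D)=r-1$ with $r\ge 2$. $\lambda$ denotes Lebesgue measure; $f$ is $\lambda$-ergodic if it is ergodic with respect to $\lambda$ on $X$. For $0<t<b$, $X_t=[0,t)$ and $f_t\colon X_t\to X_t$ is the IET induced by $f$ on $X_t$ (the first return map): $f_t(x)=f^{n(x)}(x)$ with $n(x)=\min\{n\ge 1 : f^n(x)\in X_t\}$. Weak mixing of $f_t$ relative to $\lambda$ means weak mixing with respect to (normalized) Lebesgue measure restricted to $X_t$. Residual means having meager complement. *)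

theory Defs
  imports "HOL-Probability.Probability"
begin

definition discontinuities :: "real \<Rightarrow> (real \<Rightarrow> real) \<Rightarrow> real set" where
  "discontinuities b f = {x \<in> {0..<b}. \<not> continuous (at x within {0..<b}) f}"

text \<open>
  Interval exchange transformations of $[0,b)$. Only the values of \<open>f\<close> on $[0,b)$ are
  relevant; at the end point \<open>0\<close>, continuity and the derivative are one-sided. The number
  of discontinuities is $r - 1$ with $r \ge 2$, so there is at least one.
\<close>

definition iet :: "real \<Rightarrow> (real \<Rightarrow> real) \<Rightarrow> bool" where
  "iet b f \<longleftrightarrow>
     0 < b \<and>
     bij_betw f {0..<b} {0..<b} \<and>
     (\<forall>x\<in>{0..<b}. continuous (at_right x) f) \<and>
     finite (discontinuities b f) \<and>
     discontinuities b f \<noteq> {} \<and>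
     (\<forall>x\<in>{0..<b} - discontinuities b f. (f has_real_derivative 1) (at x within {0..<b}))"

text \<open>
  For an interval exchange transformation every point of $[0,t)$ returns to $[0,t)$, so the
  \<open>LEAST\<close> below is attained.
\<close>

definition first_return_map :: "('a \<Rightarrow> 'a) \<Rightarrow> 'a set \<Rightarrow> 'a \<Rightarrow> 'a" where
  "first_return_map f A x = (f ^^ (LEAST n. 1 \<le> n \<and> (f ^^ n) x \<in> A)) x"

definition measure_preserving :: "'a measure \<Rightarrow> ('a \<Rightarrow> 'a) \<Rightarrow> bool" where
  "measure_preserving M T \<longleftrightarrow> T \<in> measurable M M \<and> distr M M T = M"

definition ergodic :: "'a measure \<Rightarrow> ('a \<Rightarrow> 'a) \<Rightarrow> bool" where
  "ergodic M T \<longleftrightarrow>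
     measure_preserving M T \<and>
     (\<forall>A\<in>sets M. T -` A \<inter> space M = A \<longrightarrow>
        emeasure M A = 0 \<or> emeasure M (space M - A) = 0)"

definition weakly_mixing :: "'a measure \<Rightarrow> ('a \<Rightarrow> 'a) \<Rightarrow> bool" where
  "weakly_mixing M T \<longleftrightarrow>
     prob_space M \<and>
     measure_preserving M T \<and>
     (\<forall>A\<in>sets M. \<forall>B\<in>sets M.
        (\<lambda>n. (\<Sum>k<n. \<bar>measure M ((T ^^ k) -` A \<inter> B) - measure M A * measure M B\<bar>) / real n)
          \<longlonglongrightarrow> 0)"

definition normalized_lebesgue_on :: "real set \<Rightarrow> real measure" where
  "normalized_lebesgue_on S = scale_measure (inverse (emeasure lebesgue S)) (lebesgue_on S)"

definition nowhere_dense_in :: "'a topology \<Rightarrow> 'a set \<Rightarrow> bool" where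
  "nowhere_dense_in X S \<longleftrightarrow> S \<subseteq> topspace X \<and> X interior_of (X closure_of S) = {}"

definition meager_in :: "'a topology \<Rightarrow> 'a set \<Rightarrow> bool" where
  "meager_in X S \<longleftrightarrow> (\<exists>\<C>. countable \<C> \<and> (\<forall>C\<in>\<C>. nowhere_dense_in X C) \<and> S = \<Union>\<C>)"

definition residual_in :: "'a topology \<Rightarrow> 'a set \<Rightarrow> bool" where
  "residual_in X S \<longleftrightarrow> S \<subseteq> topspace X \<and> meager_in X (topspace X - S)"

definition X_wm :: "real \<Rightarrow> (real \<Rightarrow> real) \<Rightarrow> real set" where
  "X_wm b f =
     {t. 0 < t \<and> t < b \<and>
         weakly_mixing (normalized_lebesgue_on {0..<t}) (first_return_map f {0..<t})}"

end

theory Submission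
  imports Defs
begin

text \<open>
  In this outline \<open>T\<close> is the map induced by \<open>f\<close> on \<open>[0, t)\<close>. Weak mixing of \<open>T\<close> follows from ergodicity
  of \<open>T \<times> T\<close> by applying an ergodic theorem for sets to products of sets
  (\<open>weakly_mixing_if_square_ergodic\<close>), so the task is to show, for most \<open>t\<close>, that a
  \<open>T \<times> T\<close>-invariant set \<open>A\<close> is trivial.

  The sections of \<open>A\<close> behave like an eigenfunction whose eigenvalue is the operator induced by \<open>T\<close>
  on sets modulo null sets: \<open>T\<^sup>-\<^sup>1 A\<^bsub>T x\<^esub> = A\<^sub>x\<close>. Extending \<open>x \<mapsto> A\<^sub>x\<close> to \<open>[0, b)\<close> along the first entry
  into \<open>[0, t)\<close> gives a family \<open>\<Phi> x\<close> with \<open>T\<^sup>-\<^sup>1 (\<Phi> (f x)) = \<Phi> x\<close> for \<open>x < t\<close> and \<open>\<Phi> (f x) = \<Phi> x\<close>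
  for \<open>x \<ge> t\<close>. Its defect, the measure of the symmetric difference of \<open>T\<^sup>-\<^sup>1 (\<Phi> x)\<close> and \<open>\<Phi> x\<close>, is
  \<open>f\<close>-invariant, hence almost everywhere constant. If the defect vanishes, almost every section of
  \<open>A\<close> is \<open>T\<close>-invariant and therefore trivial, and ergodicity of \<open>T\<close> makes \<open>A\<close> itself trivial.

  The defect is killed by a tower: a short interval \<open>I\<close> whose images \<open>I, f I, \<dots>, f\<^sup>h\<^sup>-\<^sup>1 I\<close> are disjoint
  translates covering a fixed proportion of \<open>[0, b)\<close>. As the levels are short and disjoint, \<open>\<Phi>\<close> is
  nearly constant on most of them. Suppose that \<open>t\<close> lies in the middle half of a level that is
  neither among the lowest nor among the highest quarter. Then there is one such good level at or below
  that of \<open>t\<close> and one above, and climbing from the first to the second the points on the left of \<open>t\<close> visit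
  \<open>[0, t)\<close> exactly once more than the points on the right, all other levels being on one side of
  \<open>t\<close>. So nearly the same set \<open>\<Phi>\<close> on the lower level is obtained from nearly the same set on the
  upper level by \<open>m + 1\<close> and by \<open>m\<close> applications of \<open>T\<^sup>-\<^sup>1\<close>, and the defect is small there
  (\<open>tower_forces_small_defect\<close>).

  Towers exist because the first return map to \<open>(0, c)\<close> has at most \<open>d + 2\<close> continuity intervals,
  with \<open>d\<close> the number of discontinuities, and by ergodicity the towers over them fill \<open>[0, b)\<close>; one
  of them has measure at least \<open>b / (d + 2)\<close>, whatever \<open>c\<close> (\<open>large_tower_exists\<close>). For a sequence of
  such towers with bases shrinking geometrically, the parameters \<open>t\<close> that lie in the core of
  infinitely many of them form a set of positive measure that \<open>f\<close> preserves up to a null set, by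
  Borel-Cantelli; hence it has full measure (\<open>limsup_core_conull\<close>). Being a countable intersection of
  open sets of full measure, it is also residual.
\<close>

section \<open>Measure-preserving and ergodic maps\<close>

lemma measure_preserving_iff:
  "measure_preserving M T \<longleftrightarrow>
     T \<in> measurable M M \<and> (\<forall>A\<in>sets M. emeasure M (T -` A \<inter> space M) = emeasure M A)"
proof
  assume mp: "measure_preserving M T"
  hence T: "T \<in> measurable M M" and d: "distr M M T = M"
    by (auto simp: measure_preserving_def)
  have "emeasure M (T -` A \<inter> space M) = emeasure M A" if "A \<in> sets M" for A
    using emeasure_distr[OF T that] d by simp
  with T show "T \<in> measurable M M \<and> (\<forall>A\<in>sets M. emeasure M (T -` A \<inter> space M) = emeasure M A)"
    by blast
next
  assume R: "T \<in> measurable M M \<and> (\<forall>A\<in>sets M. emeasure M (T -` A \<inter> space M) = emeasure M A)"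
  have "distr M M T = M"
    by (rule measure_eqI) (use R in \<open>auto simp: emeasure_distr\<close>)
  with R show "measure_preserving M T" by (simp add: measure_preserving_def)
qed

lemma measure_preserving_measurable:
  "measure_preserving M T \<Longrightarrow> T \<in> measurable M M"
  by (simp add: measure_preserving_def)

lemma measure_preserving_emeasure:
  "measure_preserving M T \<Longrightarrow> A \<in> sets M \<Longrightarrow> emeasure M (T -` A \<inter> space M) = emeasure M A"
  by (simp add: measure_preserving_iff)

lemma measure_preserving_measure:
  "measure_preserving M T \<Longrightarrow> A \<in> sets M \<Longrightarrow> measure M (T -` A \<inter> space M) = measure M A"
  by (simp add: measure_preserving_emeasure measure_def)

lemma measurable_funpow:
  assumes "T \<in> measurable M M"
  shows "(T ^^ k) \<in> measurable M M"
proof (induction k)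
  case (Suc k)
  show ?case unfolding funpow.simps(2) by (rule measurable_comp[OF Suc assms])
qed simp

lemma measure_preserving_funpow:
  assumes mp: "measure_preserving M T"
  shows "measure_preserving M (T ^^ k)"
proof (induction k)
  case 0
  show ?case by (auto simp: measure_preserving_iff sets.Int_space_eq2)
next
  case (Suc k)
  have T: "T \<in> measurable M M" using mp by (rule measure_preserving_measurable)
  have Tk: "(T ^^ k) \<in> measurable M M" using Suc by (rule measure_preserving_measurable)
  have "emeasure M ((T ^^ Suc k) -` A \<inter> space M) = emeasure M A" if A: "A \<in> sets M" for A
  proof -
    have "(T ^^ Suc k) -` A \<inter> space M = (T ^^ k) -` (T -` A \<inter> space M) \<inter> space M"
      using measurable_space[OF Tk] by auto
    thus ?thesis
      using measure_preserving_emeasure[OF Suc measurable_sets[OF T A]]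
        measure_preserving_emeasure[OF mp A] by simp
  qed
  thus ?case using measurable_funpow[OF T, of "Suc k"] unfolding measure_preserving_iff by blast
qed

lemma ergodic_measure_preserving: "ergodic M T \<Longrightarrow> measure_preserving M T"
  by (simp add: ergodic_def)

lemma ergodic_invariant_set:
  assumes "ergodic M T" "A \<in> sets M" "\<And>x. x \<in> space M \<Longrightarrow> T x \<in> A \<longleftrightarrow> x \<in> A"
  shows "emeasure M A = 0 \<or> emeasure M (space M - A) = 0"
proof -
  have "T -` A \<inter> space M = A"
    using assms(3) sets.sets_into_space[OF assms(2)] by auto
  with assms(1,2) show ?thesis by (auto simp: ergodic_def)
qed

text \<open>
  The points whose orbit eventually stays in \<open>A\<close> form a strictly invariant set; almost all of \<open>A\<close>
  belongs to it, and its measure is at most that of \<open>A\<close>.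
\<close>

lemma (in finite_measure) ergodic_almost_forward_invariant_set:
  assumes erg: "ergodic M T" and A: "A \<in> sets M"
    and null: "emeasure M (A - T -` A) = 0"
  shows "emeasure M A = 0 \<or> emeasure M (space M - A) = 0"
proof -
  have mp: "measure_preserving M T" using erg by (rule ergodic_measure_preserving)
  have T: "T \<in> measurable M M" using mp by (rule measure_preserving_measurable)
  note Tk[measurable] = measurable_funpow[OF T]
  note [measurable] = A T
  define C where "C N = {x \<in> space M. \<forall>n\<ge>N. (T ^^ n) x \<in> A}" for N
  \<comment> \<open>\<open>A'\<close> consists of the points whose orbit is eventually in \<open>A\<close>.\<close>
  define A' where "A' = (\<Union>N. C N)"
  have C[measurable]: "C N \<in> sets M" for N unfolding C_def by measurable
  have A'[measurable]: "A' \<in> sets M" unfolding A'_def by measurable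
  have "T x \<in> A' \<longleftrightarrow> x \<in> A'" if x: "x \<in> space M" for x
  proof
    assume "T x \<in> A'"
    then obtain N where N: "\<And>n. n \<ge> N \<Longrightarrow> (T ^^ n) (T x) \<in> A" by (auto simp: A'_def C_def)
    have "(T ^^ n) x \<in> A" if "n \<ge> Suc N" for n
      using N[of "n - 1"] that by (cases n) (auto simp: funpow_swap1)
    thus "x \<in> A'" using x by (auto simp: A'_def C_def)
  next
    assume "x \<in> A'"
    then obtain N where N: "\<And>n. n \<ge> N \<Longrightarrow> (T ^^ n) x \<in> A" by (auto simp: A'_def C_def)
    have "(T ^^ n) (T x) \<in> A" if "n \<ge> N" for n
      using N[of "Suc n"] that by (auto simp: funpow_swap1)
    thus "T x \<in> A'" using measurable_space[OF T x] by (auto simp: A'_def C_def)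
  qed
  hence dich: "emeasure M A' = 0 \<or> emeasure M (space M - A') = 0"
    by (intro ergodic_invariant_set[OF erg A'])
  define E where "E = A - T -` A"
  have E[measurable]: "E \<in> sets M"
  proof -
    have "E = A - (T -` A \<inter> space M)" using sets.sets_into_space[OF A] by (auto simp: E_def)
    thus ?thesis using A T by auto
  qed
  have sub: "A - A' \<subseteq> (\<Union>n. (T ^^ n) -` E \<inter> space M)"
  proof
    fix x assume x: "x \<in> A - A'"
    hence xs: "x \<in> space M" using sets.sets_into_space[OF A] by auto
    have "\<exists>n. (T ^^ n) x \<in> E"
    proof (rule ccontr)
      assume no: "\<nexists>n. (T ^^ n) x \<in> E"
      have "(T ^^ n) x \<in> A" for n
      proof (induction n)
        case (Suc n) thus ?case using no by (auto simp: E_def)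
      qed (use x in simp)
      hence "x \<in> A'" using xs by (auto simp: A'_def C_def)
      thus False using x by simp
    qed
    thus "x \<in> (\<Union>n. (T ^^ n) -` E \<inter> space M)" using xs by auto
  qed
  have "emeasure M (\<Union>n. (T ^^ n) -` E \<inter> space M) = 0"
  proof (rule emeasure_UN_eq_0)
    show "emeasure M ((T ^^ n) -` E \<inter> space M) = 0" for n
      using measure_preserving_emeasure[OF measure_preserving_funpow[OF mp] E] null
      by (simp add: E_def)
    show "range (\<lambda>n. (T ^^ n) -` E \<inter> space M) \<subseteq> sets M" by auto
  qed
  hence AA': "emeasure M (A - A') = 0"
    by (intro emeasure_eq_0[OF _ _ sub]) auto
  \<comment> \<open>\<open>A'\<close> is no larger than \<open>A\<close>, being an increasing union of subsets of the preimages of \<open>A\<close>.\<close>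
  have le: "emeasure M A' \<le> emeasure M A"
  proof -
    have "incseq C" by (rule incseq_SucI) (auto simp: C_def)
    hence "emeasure M A' = (SUP N. emeasure M (C N))"
      unfolding A'_def by (intro SUP_emeasure_incseq[symmetric]) auto
    also have "\<dots> \<le> emeasure M A"
    proof (rule SUP_least)
      fix N
      have "emeasure M (C N) \<le> emeasure M ((T ^^ N) -` A \<inter> space M)"
        by (rule emeasure_mono) (auto simp: C_def)
      also have "\<dots> = emeasure M A"
        by (rule measure_preserving_emeasure[OF measure_preserving_funpow[OF mp] A])
      finally show "emeasure M (C N) \<le> emeasure M A" .
    qed
    finally show ?thesis .
  qed
  from dich show ?thesis
  proof
    assume "emeasure M A' = 0"
    have "emeasure M A \<le> emeasure M ((A - A') \<union> A')" by (rule emeasure_mono) auto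
    also have "\<dots> \<le> emeasure M (A - A') + emeasure M A'" by (rule emeasure_subadditive) auto
    finally show ?thesis using AA' \<open>emeasure M A' = 0\<close> by simp
  next
    assume z: "emeasure M (space M - A') = 0"
    have "measure M (space M) = measure M A'"
      using z finite_measure_compl[OF A'] by (simp add: measure_def)
    hence "measure M A \<ge> measure M (space M)"
      using le by (simp add: emeasure_eq_measure)
    hence "measure M (space M - A) = 0"
      using finite_measure_compl[OF A] measure_nonneg[of M "space M - A"] by linarith
    thus ?thesis by (simp add: emeasure_eq_measure)
  qed
qed

lemma AE_scale_measure:
  assumes "AE x in M. P x"
  shows "AE x in scale_measure r M. P x"
proof -
  obtain S where "{x \<in> space M. \<not> P x} \<subseteq> S" "emeasure M S = 0" "S \<in> sets M"
    using assms by (rule AE_E)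
  thus ?thesis by (intro AE_I[of _ _ S]) (simp_all add: space_scale_measure)
qed

lemma measure_preserving_scale_measure:
  "measure_preserving M T \<Longrightarrow> measure_preserving (scale_measure r M) T"
  by (auto simp: measure_preserving_iff measurable_def space_scale_measure)

lemma ergodic_scale_measure: "ergodic M T \<Longrightarrow> ergodic (scale_measure r M) T"
  by (auto simp: ergodic_def measure_preserving_scale_measure space_scale_measure)

lemma measurable_map_prod:
  assumes "S \<in> measurable M M'" "T \<in> measurable N N'"
  shows "map_prod S T \<in> measurable (M \<Otimes>\<^sub>M N) (M' \<Otimes>\<^sub>M N')"
  unfolding map_prod_def case_prod_beta
  by (intro measurable_Pair measurable_compose[OF measurable_fst assms(1)]
      measurable_compose[OF measurable_snd assms(2)])

lemma measure_preserving_map_prod: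
  assumes "sigma_finite_measure N" "measure_preserving M S" "measure_preserving N T"
  shows "measure_preserving (M \<Otimes>\<^sub>M N) (map_prod S T)"
proof -
  have S: "S \<in> measurable M M" "distr M M S = M" and T: "T \<in> measurable N N" "distr N N T = N"
    using assms by (auto simp: measure_preserving_def)
  have "distr M M S \<Otimes>\<^sub>M distr N N T = distr (M \<Otimes>\<^sub>M N) (M \<Otimes>\<^sub>M N) (\<lambda>(x, y). (S x, T y))"
    using assms(1) T(2) by (intro pair_measure_distr S T) simp
  hence "distr (M \<Otimes>\<^sub>M N) (M \<Otimes>\<^sub>M N) (map_prod S T) = M \<Otimes>\<^sub>M N"
    using S(2) T(2) by (simp add: map_prod_def)
  moreover have "map_prod S T \<in> measurable (M \<Otimes>\<^sub>M N) (M \<Otimes>\<^sub>M N)"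
    by (rule measurable_map_prod[OF S(1) T(1)])
  ultimately show ?thesis by (simp add: measure_preserving_def)
qed

section \<open>The ergodic theorem for sets\<close>

definition visits :: "('a \<Rightarrow> 'a) \<Rightarrow> 'a set \<Rightarrow> nat \<Rightarrow> 'a \<Rightarrow> real" where
  "visits T A n x = (\<Sum>k<n. indicator A ((T ^^ k) x))"

lemma funpow_funpow: "(f ^^ m) ((f ^^ n) x) = (f ^^ (m + n)) x"
  by (simp add: funpow_add)

lemma visits_add: "visits T A (m + n) x = visits T A m x + visits T A n ((T ^^ m) x)"
  by (induction n) (simp_all add: visits_def funpow_funpow add.commute)

lemma visits_Suc: "visits T A (Suc n) x = indicator A x + visits T A n (T x)"
  using visits_add[of T A 1 n x] by (simp add: visits_def)

lemma visits_nonneg: "0 \<le> visits T A n x"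
  by (simp add: visits_def sum_nonneg)

lemma visits_le: "visits T A n x \<le> real n"
  unfolding visits_def using sum_mono[of "{..<n}" "\<lambda>k. indicator A ((T ^^ k) x) :: real" "\<lambda>_. 1"]
  by (auto simp: indicator_def)

lemma visits_mono: "A \<subseteq> B \<Longrightarrow> visits T A n x \<le> visits T B n x"
  unfolding visits_def by (rule sum_mono) (auto simp: indicator_def)

lemma visits_compl:
  assumes "T \<in> measurable M M" "x \<in> space M"
  shows "visits T (space M - A) n x = real n - visits T A n x"
proof -
  have "(T ^^ k) x \<in> space M" for k
    using measurable_space[OF measurable_funpow[OF assms(1)] assms(2)] .
  hence "visits T (space M - A) n x = (\<Sum>k<n. 1 - indicator A ((T ^^ k) x))"
    unfolding visits_def by (intro sum.cong) (auto simp: indicator_def)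
  thus ?thesis by (simp add: visits_def sum_subtractf)
qed

lemma borel_measurable_visits:
  assumes [measurable]: "T \<in> measurable M M" "A \<in> sets M"
  shows "visits T A n \<in> borel_measurable M"
proof -
  note [measurable] = measurable_funpow[OF assms(1)]
  show ?thesis unfolding visits_def[abs_def] by measurable
qed

lemma (in prob_space) integral_visits:
  assumes mp: "measure_preserving M T" and A: "A \<in> sets M"
  shows "(\<integral>x. visits T A n x \<partial>M) = real n * prob A"
    and "integrable M (visits T A n)"
proof -
  have T: "T \<in> measurable M M" using mp by (rule measure_preserving_measurable)
  note [measurable] = measurable_funpow[OF T] A
  have int: "integrable M (\<lambda>x. indicator A ((T ^^ k) x) :: real)" for k
    by (rule integrable_const_bound[where B=1]) (auto simp: indicator_def)
  have "(\<integral>x. indicator A ((T ^^ k) x) \<partial>M) = prob A" for k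
  proof -
    have "(\<integral>x. indicator A ((T ^^ k) x) \<partial>M) = (\<integral>x. indicator ((T ^^ k) -` A \<inter> space M) x \<partial>M)"
      by (rule Bochner_Integration.integral_cong) (auto simp: indicator_def)
    also have "\<dots> = prob ((T ^^ k) -` A \<inter> space M)" by simp
    finally show ?thesis
      using measure_preserving_measure[OF measure_preserving_funpow[OF mp, of k] A] by simp
  qed
  thus "(\<integral>x. visits T A n x \<partial>M) = real n * prob A"
    unfolding visits_def using int by simp
  show "integrable M (visits T A n)" unfolding visits_def[abs_def] using int by simp
qed

text \<open>
  Unboundedness of \<open>visits T A n x - q * n\<close> is an exactly invariant property of \<open>x\<close>, so if it fails to
  be almost surely false, it is almost surely true. Then almost every orbit can be cut into
  finite blocks with visit frequency at least \<open>q\<close>, and integrating the number of visits gives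
  \<open>q \<le> prob A\<close>, a contradiction.
\<close>

lemma (in prob_space) ergodic_visits_upper:
  assumes erg: "ergodic M T" and A: "A \<in> sets M" and q: "prob A < q"
  shows "AE x in M. \<exists>C::nat. \<forall>n. visits T A n x \<le> q * real n + real C"
proof (cases "q \<le> 1")
  case False
  have "visits T A n x \<le> q * real n + real 0" for n x
    using visits_le[of T A n x] False mult_right_mono[of 1 q "real n"] by simp
  thus ?thesis by blast
next
  case True
  have mp: "measure_preserving M T" using erg by (rule ergodic_measure_preserving)
  have T: "T \<in> measurable M M" using mp by (rule measure_preserving_measurable)
  note [measurable] = borel_measurable_visits[OF T A] A T
  have q0: "0 \<le> q" using q measure_nonneg[of M A] by linarith
  define Z where "Z = {x \<in> space M. \<forall>C::nat. \<exists>n. visits T A n x > q * real n + real C}"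
  have Z[measurable]: "Z \<in> sets M" unfolding Z_def by measurable
  have "T x \<in> Z \<longleftrightarrow> x \<in> Z" if x: "x \<in> space M" for x
  proof
    assume l: "T x \<in> Z"
    have "\<exists>n. visits T A n x > q * real n + real C" for C
    proof -
      obtain n where "visits T A n (T x) > q * real n + real (C + 1)"
        using l unfolding Z_def by blast
      hence "visits T A (Suc n) x > q * real (Suc n) + real C"
        using True q0 by (simp add: visits_Suc indicator_def algebra_simps)
      thus ?thesis by blast
    qed
    thus "x \<in> Z" using x by (simp add: Z_def)
  next
    assume l: "x \<in> Z"
    have "\<exists>n. visits T A n (T x) > q * real n + real C" for C
    proof -
      obtain n where n: "visits T A n x > q * real n + real (C + 1)"
        using l unfolding Z_def by blast
      show ?thesis
      proof (cases n)
        case 0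
        with n show ?thesis by (simp add: visits_def)
      next
        case (Suc m)
        have "visits T A m (T x) > q * real m + real C"
          using n q0 unfolding Suc by (cases "x \<in> A") (simp_all add: visits_Suc algebra_simps)
        thus ?thesis by blast
      qed
    qed
    thus "T x \<in> Z" using measurable_space[OF T x] by (simp add: Z_def)
  qed
  hence "emeasure M Z = 0 \<or> emeasure M (space M - Z) = 0"
    by (intro ergodic_invariant_set[OF erg Z])
  moreover have "emeasure M (space M - Z) \<noteq> 0"
  proof
    assume full: "emeasure M (space M - Z) = 0"
    define Bd where "Bd L = {x \<in> space M. \<forall>n\<in>{1..L}. visits T A n x < q * real n}" for L :: nat
    have Bd[measurable]: "Bd L \<in> sets M" for L unfolding Bd_def by measurable
    have "(\<lambda>L. prob (Bd L)) \<longlonglongrightarrow> prob (\<Inter>L. Bd L)"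
      by (rule finite_Lim_measure_decseq) (auto simp: decseq_def Bd_def)
    moreover have "prob (\<Inter>L. Bd L) = 0"
    proof -
      have "(\<Inter>L. Bd L) \<subseteq> space M - Z"
      proof
        fix x assume x: "x \<in> (\<Inter>L. Bd L)"
        have "visits T A n x \<le> q * real n + real 0" for n
        proof (cases "n = 0")
          case False
          have "x \<in> Bd n" using x by blast
          thus ?thesis using False by (auto simp: Bd_def intro!: less_imp_le)
        qed (simp add: visits_def)
        hence "x \<notin> Z" unfolding Z_def by (auto simp: not_less intro!: exI[of _ 0])
        moreover have "x \<in> space M" using x by (auto simp: Bd_def)
        ultimately show "x \<in> space M - Z" by simp
      qed
      hence "prob (\<Inter>L. Bd L) \<le> prob (space M - Z)" by (rule finite_measure_mono) auto
      also have "\<dots> = 0" using full by (simp add: emeasure_eq_measure)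
      finally show ?thesis using measure_le_0_iff by blast
    qed
    ultimately have "(\<lambda>L. prob (Bd L)) \<longlonglongrightarrow> 0" by simp
    hence "\<forall>\<^sub>F L in sequentially. prob (Bd L) < q - prob A"
      using q by (intro order_tendstoD) auto
    then obtain L where L: "prob (Bd L) < q - prob A"
      using eventually_sequentially by auto
    \<comment> \<open>Enlarging \<open>A\<close> by the points whose visits stay sparse up to time \<open>L\<close>, every orbit
      segment splits into blocks of length at most \<open>L\<close> with visit frequency at least \<open>q\<close>.\<close>
    define A' where "A' = A \<union> Bd L"
    have A'[measurable]: "A' \<in> sets M" by (simp add: A'_def)
    have low: "q * (real n - real L) \<le> visits T A' n x" if "x \<in> space M" for n x
      using that
    proof (induction n arbitrary: x rule: less_induct)
      case (less n)
      show ?case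
      proof (cases "n \<le> L")
        case True
        hence "q * (real n - real L) \<le> 0" using q0 by (simp add: mult_le_0_iff)
        thus ?thesis using visits_nonneg[of T A' n x] by linarith
      next
        case nL: False
        show ?thesis
        proof (cases "x \<in> Bd L")
          case True
          obtain m where m: "n = Suc m" using nL by (cases n) auto
          have "q * (real m - real L) \<le> visits T A' m (T x)"
            using less.IH[of m "T x"] m measurable_space[OF T less.prems] by simp
          moreover have "x \<in> A'" using True by (simp add: A'_def)
          ultimately show ?thesis using \<open>q \<le> 1\<close> unfolding m by (simp add: visits_Suc algebra_simps)
        next
          case False
          then obtain m where m: "m \<in> {1..L}" "visits T A m x \<ge> q * real m"
            using less.prems by (auto simp: Bd_def not_less)
          have "q * (real (n - m) - real L) \<le> visits T A' (n - m) ((T ^^ m) x)"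
            using less.IH[of "n - m" "(T ^^ m) x"] m nL
              measurable_space[OF measurable_funpow[OF T] less.prems] by simp
          moreover have "q * real m \<le> visits T A' m x"
            using m(2) visits_mono[of A A' T m x] by (auto simp: A'_def)
          moreover have "visits T A' n x = visits T A' m x + visits T A' (n - m) ((T ^^ m) x)"
            using visits_add[of T A' m "n - m" x] m nL by simp
          moreover have "real (n - m) = real n - real m" using m nL by simp
          ultimately show ?thesis by (simp add: algebra_simps)
        qed
      qed
    qed
    have avg: "q * (real n - real L) \<le> real n * prob A'" for n
    proof -
      have "q * (real n - real L) = (\<integral>x. q * (real n - real L) \<partial>M)"
        by (simp add: prob_space)
      also have "\<dots> \<le> (\<integral>x. visits T A' n x \<partial>M)"
        using integral_visits[OF mp A'] low by (intro integral_mono) auto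
      finally show ?thesis using integral_visits[OF mp A'] by simp
    qed
    have "prob A' \<le> prob A + prob (Bd L)" unfolding A'_def by (rule measure_Un_le) auto
    hence lt: "prob A' < q" using L by linarith
    obtain n :: nat where n: "q * real L / (q - prob A') < real n" using reals_Archimedean2 by blast
    hence "q * real L < real n * (q - prob A')" using lt by (simp add: divide_simps)
    thus False using avg[of n] by (simp add: algebra_simps)
  qed
  ultimately have "emeasure M Z = 0" by blast
  hence "AE x in M. x \<notin> Z" using Z by (intro AE_not_in) (auto simp: null_sets_def)
  thus ?thesis by (rule AE_mp) (auto simp: Z_def not_less intro!: AE_I2)
qed

text \<open>
  The pointwise ergodic theorem for indicator functions of an ergodic map: the lower bound is the
  upper bound for the complement of \<open>A\<close>.
\<close>

lemma (in prob_space) ergodic_visits_tendsto: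
  assumes erg: "ergodic M T" and A: "A \<in> sets M"
  shows "AE x in M. (\<lambda>n. visits T A n x / real n) \<longlonglongrightarrow> prob A"
proof -
  have T: "T \<in> measurable M M"
    using erg by (intro measure_preserving_measurable ergodic_measure_preserving)
  have bound: "\<forall>\<^sub>F n in sequentially. s n / real n < a + e"
    if "\<forall>n. s n \<le> (a + e / 2) * real n + real C" "e > 0" for s :: "nat \<Rightarrow> real" and a e C
  proof -
    obtain N :: nat where N: "2 * real C / e < real N" using reals_Archimedean2 by blast
    have "s n / real n < a + e" if n: "n \<ge> Suc N" for n
    proof -
      have "2 * real C / e < real n" using N n by linarith
      hence "2 * real C < e * real n" using \<open>e > 0\<close> by (simp add: divide_simps mult.commute)
      moreover have "s n \<le> (a + e / 2) * real n + real C" using \<open>\<forall>n. s n \<le> _\<close> by blast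
      ultimately have "s n < (a + e) * real n" by (simp add: algebra_simps)
      thus ?thesis using n by (simp add: divide_simps)
    qed
    thus ?thesis unfolding eventually_sequentially by blast
  qed
  have "AE x in M. \<forall>i::nat. (\<exists>C::nat. \<forall>n. visits T A n x \<le> (prob A + 1 / Suc i / 2) * real n + real C) \<and>
      (\<exists>C::nat. \<forall>n. visits T (space M - A) n x \<le> (prob (space M - A) + 1 / Suc i / 2) * real n + real C)"
    unfolding AE_all_countable
    by (intro allI AE_conjI ergodic_visits_upper[OF erg]) (use A in auto)
  thus ?thesis
  proof (rule AE_mp, intro AE_I2 impI)
    fix x assume x: "x \<in> space M" and
      H: "\<forall>i::nat. (\<exists>C::nat. \<forall>n. visits T A n x \<le> (prob A + 1 / Suc i / 2) * real n + real C) \<and>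
      (\<exists>C::nat. \<forall>n. visits T (space M - A) n x \<le> (prob (space M - A) + 1 / Suc i / 2) * real n + real C)"
    show "(\<lambda>n. visits T A n x / real n) \<longlonglongrightarrow> prob A"
    proof (rule LIMSEQ_I)
      fix r :: real assume "r > 0"
      then obtain i :: nat where i: "1 / Suc i < r" by (metis nat_approx_posE)
      have "\<forall>\<^sub>F n in sequentially. visits T A n x / real n < prob A + 1 / Suc i"
        using H[rule_format, of i] bound[of "\<lambda>n. visits T A n x"] by auto
      moreover have "\<forall>\<^sub>F n in sequentially. visits T (space M - A) n x / real n < prob (space M - A) + 1 / Suc i"
        using H[rule_format, of i] bound[of "\<lambda>n. visits T (space M - A) n x"] by auto
      ultimately have "\<forall>\<^sub>F n in sequentially. norm (visits T A n x / real n - prob A) < r"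
        using eventually_gt_at_top[of 0]
      proof eventually_elim
        case (elim n)
        have "visits T (space M - A) n x / real n = 1 - visits T A n x / real n"
          using visits_compl[OF T x, of A n] elim(3) by (simp add: divide_simps)
        thus ?case using elim i prob_compl[OF A] by auto
      qed
      thus "\<exists>no. \<forall>n\<ge>no. norm (visits T A n x / real n - prob A) < r"
        by (simp add: eventually_sequentially)
    qed
  qed
qed

lemma (in prob_space) ergodic_mean_correlation:
  assumes erg: "ergodic M T" and A: "A \<in> sets M" and B: "B \<in> sets M"
  shows "(\<lambda>n. (\<Sum>k<n. prob ((T ^^ k) -` A \<inter> B)) / real n) \<longlonglongrightarrow> prob A * prob B"
proof -
  have mp: "measure_preserving M T" using erg by (rule ergodic_measure_preserving)
  have T: "T \<in> measurable M M" using mp by (rule measure_preserving_measurable)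
  note [measurable] = borel_measurable_visits[OF T A] A B T measurable_funpow[OF T]
  have "(\<lambda>n. \<integral>x. indicator B x * (visits T A n x / real n) \<partial>M) \<longlonglongrightarrow> (\<integral>x. indicator B x * prob A \<partial>M)"
  proof (rule integral_dominated_convergence[where w="\<lambda>_. 1"])
    show "AE x in M. (\<lambda>n. indicator B x * (visits T A n x / real n)) \<longlonglongrightarrow> indicator B x * prob A"
      using ergodic_visits_tendsto[OF erg A] by eventually_elim (intro tendsto_intros)
    show "AE x in M. norm (indicator B x * (visits T A n x / real n)) \<le> 1" for n
      using visits_le[of T A n] visits_nonneg[of T A n]
      by (intro AE_I2) (auto simp: indicator_def divide_simps)
  qed auto
  moreover have "(\<integral>x. indicator B x * (visits T A n x / real n) \<partial>M)
      = (\<Sum>k<n. prob ((T ^^ k) -` A \<inter> B)) / real n" for n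
  proof -
    have "(\<integral>x. indicator B x * (visits T A n x / real n) \<partial>M)
        = (\<integral>x. (\<Sum>k<n. indicator ((T ^^ k) -` A \<inter> B) x) / real n \<partial>M)"
      by (rule Bochner_Integration.integral_cong)
         (auto simp: visits_def indicator_def sum_distrib_left intro!: sum.cong)
    also have "\<dots> = (\<Sum>k<n. prob ((T ^^ k) -` A \<inter> B)) / real n"
    proof -
      have S: "(T ^^ k) -` A \<inter> B \<in> sets M" for k
      proof -
        have "(T ^^ k) -` A \<inter> B = ((T ^^ k) -` A \<inter> space M) \<inter> B"
          using sets.sets_into_space[OF B] by auto
        thus ?thesis by (simp del: Int_assoc) measurable
      qed
      have "integrable M (indicator ((T ^^ k) -` A \<inter> B) :: _ \<Rightarrow> real)" for k
        using S by (intro integrable_real_indicator) (auto simp: emeasure_eq_measure)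
      thus ?thesis using S by (simp add: Int_absorb2 sets.Int_space_eq1)
    qed
    finally show ?thesis .
  qed
  ultimately show ?thesis by (simp only: mult.commute[of "prob A"]) (simp add: B)
qed

section \<open>Ergodicity of the square implies weak mixing\<close>

lemma funpow_map_prod:
  fixes f :: "'a \<Rightarrow> 'a" and g :: "'b \<Rightarrow> 'b"
  shows "(map_prod f g ^^ k) (x, y) = ((f ^^ k) x, (g ^^ k) y)"
  by (induction k) auto

text \<open>
  For \<open>d k = \<mu> (T\<^sup>-\<^sup>k A \<inter> B)\<close> the averages of \<open>d\<close> and of \<open>d\<^sup>2\<close> converge to \<open>c = \<mu> A * \<mu> B\<close> and \<open>c\<^sup>2\<close>, by
  mean ergodicity of \<open>T \<times> T\<close> on \<open>A \<times> space M\<close> and on \<open>A \<times> A\<close>. So the averages of \<open>(d - c)\<^sup>2\<close> tend to \<open>0\<close>,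
  and those of \<open>\<bar>d - c\<bar>\<close> do by Cauchy-Schwarz.
\<close>

lemma (in prob_space) weakly_mixing_if_square_ergodic:
  assumes mp: "measure_preserving M T"
    and erg: "ergodic (M \<Otimes>\<^sub>M M) (map_prod T T)"
  shows "weakly_mixing M T"
proof -
  interpret MM: pair_prob_space M M ..
  have T: "T \<in> measurable M M" using mp by (rule measure_preserving_measurable)
  have "(\<lambda>n. (\<Sum>k<n. \<bar>measure M ((T ^^ k) -` A \<inter> B) - measure M A * measure M B\<bar>) / real n)
          \<longlonglongrightarrow> 0" if A: "A \<in> sets M" and B: "B \<in> sets M" for A B
  proof -
    define c where "c = measure M A * measure M B"
    define d where "d k = measure M ((T ^^ k) -` A \<inter> B)" for k
    have TA: "(T ^^ k) -` A \<inter> B \<in> sets M" for k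
    proof -
      have "(T ^^ k) -` A \<inter> B = ((T ^^ k) -` A \<inter> space M) \<inter> B"
        using sets.sets_into_space[OF B] by auto
      thus ?thesis using measurable_sets[OF measurable_funpow[OF T] A] B by simp
    qed
    have times: "measure (M \<Otimes>\<^sub>M M) (P \<times> Q) = measure M P * measure M Q"
      if "P \<in> sets M" "Q \<in> sets M" for P Q
      using that by (simp add: measure_def emeasure_pair_measure_Times enn2real_mult)
    have "(\<lambda>n. (\<Sum>k<n. measure (M \<Otimes>\<^sub>M M) ((map_prod T T ^^ k) -` (A \<times> A) \<inter> (B \<times> B))) / real n)
        \<longlonglongrightarrow> measure (M \<Otimes>\<^sub>M M) (A \<times> A) * measure (M \<Otimes>\<^sub>M M) (B \<times> B)"
      by (rule MM.ergodic_mean_correlation[OF erg]) (use A B in auto)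
    moreover have "(map_prod T T ^^ k) -` (A \<times> A) \<inter> (B \<times> B)
        = ((T ^^ k) -` A \<inter> B) \<times> ((T ^^ k) -` A \<inter> B)" for k
      by (auto simp: funpow_map_prod)
    ultimately have sq: "(\<lambda>n. (\<Sum>k<n. (d k)\<^sup>2) / real n) \<longlonglongrightarrow> c\<^sup>2"
      using A B TA by (simp add: times d_def c_def power2_eq_square mult_ac)
    have "(\<lambda>n. (\<Sum>k<n. measure (M \<Otimes>\<^sub>M M) ((map_prod T T ^^ k) -` (A \<times> space M) \<inter> (B \<times> space M))) / real n)
        \<longlonglongrightarrow> measure (M \<Otimes>\<^sub>M M) (A \<times> space M) * measure (M \<Otimes>\<^sub>M M) (B \<times> space M)"
      by (rule MM.ergodic_mean_correlation[OF erg]) (use A B in auto)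
    moreover have "(map_prod T T ^^ k) -` (A \<times> space M) \<inter> (B \<times> space M)
        = ((T ^^ k) -` A \<inter> B) \<times> space M" for k
      using measurable_space[OF measurable_funpow[OF T]] by (auto simp: funpow_map_prod)
    ultimately have lin: "(\<lambda>n. (\<Sum>k<n. d k) / real n) \<longlonglongrightarrow> c"
      using A B TA by (simp add: times d_def c_def prob_space)
    have "(\<lambda>n. (\<Sum>k<n. (d k)\<^sup>2) / real n - 2 * c * ((\<Sum>k<n. d k) / real n) + c\<^sup>2) \<longlonglongrightarrow> c\<^sup>2 - 2 * c * c + c\<^sup>2"
      by (intro tendsto_intros sq lin)
    hence var: "(\<lambda>n. (\<Sum>k<n. (d k)\<^sup>2) / real n - 2 * c * ((\<Sum>k<n. d k) / real n) + c\<^sup>2) \<longlonglongrightarrow> 0"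
      by (simp add: power2_eq_square)
    have le: "(\<Sum>k<n. \<bar>d k - c\<bar>) / real n
        \<le> sqrt ((\<Sum>k<n. (d k)\<^sup>2) / real n - 2 * c * ((\<Sum>k<n. d k) / real n) + c\<^sup>2)" if "n > 0" for n
    proof -
      have "(\<Sum>k<n. \<bar>d k - c\<bar> * 1)\<^sup>2 \<le> (\<Sum>k<n. \<bar>d k - c\<bar>\<^sup>2) * (\<Sum>k<n. 1\<^sup>2)"
        by (rule Cauchy_Schwarz_ineq_sum)
      also have "(\<Sum>k<n. \<bar>d k - c\<bar>\<^sup>2) = (\<Sum>k<n. (d k)\<^sup>2) - 2 * c * (\<Sum>k<n. d k) + real n * c\<^sup>2"
        by (simp add: power2_diff sum.distrib sum_subtractf sum_distrib_left mult_ac)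
      finally have "((\<Sum>k<n. \<bar>d k - c\<bar>) / real n)\<^sup>2
          \<le> (\<Sum>k<n. (d k)\<^sup>2) / real n - 2 * c * ((\<Sum>k<n. d k) / real n) + c\<^sup>2"
        using that by (simp add: power_divide divide_simps power2_eq_square algebra_simps)
      thus ?thesis by (rule real_le_rsqrt)
    qed
    have "(\<lambda>n. (\<Sum>k<n. \<bar>d k - c\<bar>) / real n) \<longlonglongrightarrow> 0"
    proof (rule tendsto_sandwich[OF _ _ tendsto_const])
      show "\<forall>\<^sub>F n in sequentially. 0 \<le> (\<Sum>k<n. \<bar>d k - c\<bar>) / real n"
        by (intro always_eventually allI divide_nonneg_nonneg sum_nonneg) auto
      show "\<forall>\<^sub>F n in sequentially. (\<Sum>k<n. \<bar>d k - c\<bar>) / real n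
        \<le> sqrt ((\<Sum>k<n. (d k)\<^sup>2) / real n - 2 * c * ((\<Sum>k<n. d k) / real n) + c\<^sup>2)"
        using eventually_gt_at_top[of 0] by eventually_elim (rule le)
      show "(\<lambda>n. sqrt ((\<Sum>k<n. (d k)\<^sup>2) / real n - 2 * c * ((\<Sum>k<n. d k) / real n) + c\<^sup>2)) \<longlonglongrightarrow> 0"
        using tendsto_real_sqrt[OF var] by simp
    qed
    thus ?thesis by (simp add: d_def c_def)
  qed
  thus ?thesis using mp prob_space_axioms by (simp add: weakly_mixing_def)
qed

section \<open>Induced maps\<close>

definition returns :: "('a \<Rightarrow> 'a) \<Rightarrow> 'a set \<Rightarrow> 'a set" where
  "returns f A = {x. \<exists>n\<ge>1. (f ^^ n) x \<in> A}"

text \<open>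
  With a constant value on the points that never enter \<open>A\<close>, the value is unchanged by \<open>f\<close> at every
  point outside \<open>A\<close>, without exceptional null sets.
\<close>

definition entry_map :: "('a \<Rightarrow> 'a) \<Rightarrow> 'a set \<Rightarrow> 'a \<Rightarrow> 'a \<Rightarrow> 'a" where
  "entry_map f A a x = (if \<exists>n. (f ^^ n) x \<in> A then (f ^^ (LEAST n. (f ^^ n) x \<in> A)) x else a)"

lemma entry_map_in: "x \<in> A \<Longrightarrow> entry_map f A a x = x"
proof -
  assume x: "x \<in> A"
  hence "(LEAST n. (f ^^ n) x \<in> A) = 0" by (intro Least_equality) auto
  moreover have "\<exists>n. (f ^^ n) x \<in> A" using x by (intro exI[of _ 0]) simp
  ultimately show ?thesis by (simp add: entry_map_def)
qed

lemma entry_map_mem: "a \<in> A \<Longrightarrow> entry_map f A a x \<in> A"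
  unfolding entry_map_def using LeastI_ex[of "\<lambda>n. (f ^^ n) x \<in> A"] by auto

lemma entry_map_step: "x \<notin> A \<Longrightarrow> entry_map f A a (f x) = entry_map f A a x"
proof -
  assume x: "x \<notin> A"
  have ex: "(\<exists>n. (f ^^ n) x \<in> A) \<longleftrightarrow> (\<exists>n. (f ^^ n) (f x) \<in> A)"
  proof
    assume "\<exists>n. (f ^^ n) x \<in> A"
    then obtain n where n: "(f ^^ n) x \<in> A" by blast
    with x obtain m where "n = Suc m" by (cases n) auto
    with n show "\<exists>n. (f ^^ n) (f x) \<in> A" by (auto simp: funpow_swap1)
  next
    assume "\<exists>n. (f ^^ n) (f x) \<in> A"
    then obtain n where "(f ^^ n) (f x) \<in> A" by blast
    hence "(f ^^ Suc n) x \<in> A" by (simp add: funpow_swap1)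
    thus "\<exists>n. (f ^^ n) x \<in> A" by blast
  qed
  show ?thesis
  proof (cases "\<exists>n. (f ^^ n) x \<in> A")
    case True
    then obtain n where n: "(f ^^ n) x \<in> A" by blast
    have "(LEAST n. (f ^^ n) x \<in> A) = Suc (LEAST n. (f ^^ Suc n) x \<in> A)"
      using n x by (intro Least_Suc[of "\<lambda>n. (f ^^ n) x \<in> A" n]) auto
    thus ?thesis using True ex by (simp add: entry_map_def funpow_swap1)
  qed (use ex in \<open>simp add: entry_map_def\<close>)
qed

lemma first_return_map_eq_entry_map:
  assumes "x \<in> returns f A"
  shows "first_return_map f A x = entry_map f A a (f x)"
proof -
  obtain n where n: "n \<ge> 1" "(f ^^ n) x \<in> A" using assms by (auto simp: returns_def)
  then obtain m where m: "n = Suc m" by (cases n) auto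
  have "(LEAST n. 1 \<le> n \<and> (f ^^ n) x \<in> A) = Suc (LEAST m. 1 \<le> Suc m \<and> (f ^^ Suc m) x \<in> A)"
    using n by (intro Least_Suc[of "\<lambda>n. 1 \<le> n \<and> (f ^^ n) x \<in> A" n]) auto
  moreover have "\<exists>m. (f ^^ m) (f x) \<in> A" using n m by (auto simp: funpow_swap1)
  ultimately show ?thesis by (simp add: first_return_map_def entry_map_def funpow_swap1)
qed

lemma measurable_entry_map:
  assumes f: "f \<in> measurable M M" and A: "A \<in> sets M" and a: "a \<in> A"
  shows "entry_map f A a \<in> measurable M (restrict_space M A)"
proof -
  note [measurable] = measurable_funpow[OF f] A
  have aM: "a \<in> space M" using a A sets.sets_into_space by blast
  define N where "N x = (LEAST n. (f ^^ n) x \<in> A)" for x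
  have N[measurable]: "N \<in> measurable M (count_space UNIV)"
    unfolding N_def[abs_def] by measurable
  have "(\<lambda>x. if \<exists>n. (f ^^ n) x \<in> A then (f ^^ N x) x else a) \<in> measurable M M"
    using aM by measurable
  hence "entry_map f A a \<in> measurable M M"
    unfolding N_def entry_map_def[abs_def] .
  thus ?thesis using entry_map_mem[OF a] by (intro measurable_restrict_space2) auto
qed

lemma measurable_first_return_map:
  assumes f: "f \<in> measurable M M" and A: "A \<in> sets M" and ret: "A \<subseteq> returns f A"
  shows "first_return_map f A \<in> measurable (restrict_space M A) (restrict_space M A)"
proof (cases "A = {}")
  case True
  thus ?thesis by (auto simp: measurable_def space_restrict_space sets_restrict_space)
next
  case False
  then obtain a where a: "a \<in> A" by blast
  have "(\<lambda>x. entry_map f A a (f x)) \<in> measurable (restrict_space M A) (restrict_space M A)"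
    by (intro measurable_restrict_space1 measurable_compose[OF f measurable_entry_map] f A a)
  moreover have "first_return_map f A x = entry_map f A a (f x)"
    if "x \<in> space (restrict_space M A)" for x
    using first_return_map_eq_entry_map[of x f A a] ret that by (auto simp: space_restrict_space)
  ultimately show ?thesis by (rule measurable_cong[THEN iffD2, rotated])
qed

text \<open>
  Pulling \<open>S\<close> back by \<open>f\<close> again and again, and splitting off the part that lies in \<open>A\<close> each time,
  produces disjoint pieces that exhaust the preimage of \<open>S\<close> under the first return map, while the
  total mass stays \<open>measure M S\<close>.
\<close>

lemma (in finite_measure) first_return_map_vimage_le:
  assumes mp: "measure_preserving M f" and A: "A \<in> sets M" and ret: "A \<subseteq> returns f A"
    and S: "S \<in> sets M" "S \<subseteq> A"
  shows "measure M (first_return_map f A -` S \<inter> A) \<le> measure M S"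
proof -
  have f: "f \<in> measurable M M" using mp by (rule measure_preserving_measurable)
  note [measurable] = measurable_funpow[OF f] A S(1)
  \<comment> \<open>\<open>R m\<close>: points of \<open>A\<close> whose first return happens at time \<open>m + 1\<close> and lies in \<open>S\<close>;
    \<open>Q m\<close>: points that enter \<open>A\<close> first at time \<open>m\<close>, at a point of \<open>S\<close>.\<close>
  define R where "R m = {x \<in> space M. x \<in> A \<and> (f ^^ Suc m) x \<in> S \<and> (\<forall>j\<in>{1..m}. (f ^^ j) x \<notin> A)}" for m
  define Q where "Q m = {x \<in> space M. (f ^^ m) x \<in> S \<and> (\<forall>j<m. (f ^^ j) x \<notin> A)}" for m
  have R[measurable]: "R m \<in> sets M" for m unfolding R_def by measurable
  have Q[measurable]: "Q m \<in> sets M" for m unfolding Q_def by measurable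
  have step: "measure M (Q m) = measure M (R m) + measure M (Q (Suc m))" for m
  proof -
    have "f -` Q m \<inter> space M = R m \<union> Q (Suc m)"
    proof (intro equalityI subsetI)
      fix x assume x: "x \<in> f -` Q m \<inter> space M"
      hence 1: "(f ^^ Suc m) x \<in> S" and 2: "\<And>j. j < m \<Longrightarrow> (f ^^ Suc j) x \<notin> A" and 3: "x \<in> space M"
        by (auto simp: Q_def funpow_swap1)
      have 4: "(f ^^ j) x \<notin> A" if "j \<in> {1..m}" for j using 2[of "j - 1"] that by (cases j) auto
      show "x \<in> R m \<union> Q (Suc m)"
      proof (cases "x \<in> A")
        case True
        thus ?thesis using 1 3 4 by (auto simp: R_def)
      next
        case False
        have "(f ^^ j) x \<notin> A" if "j < Suc m" for j using 4[of j] False that by (cases j) auto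
        thus ?thesis using 1 3 by (auto simp: Q_def)
      qed
    next
      fix x assume x: "x \<in> R m \<union> Q (Suc m)"
      hence "x \<in> space M" "(f ^^ m) (f x) \<in> S" by (auto simp: R_def Q_def funpow_swap1)
      moreover have "(f ^^ j) (f x) \<notin> A" if "j < m" for j
      proof -
        have "(f ^^ Suc j) x \<notin> A" using x that by (auto simp: R_def Q_def simp del: funpow.simps)
        thus ?thesis by (simp add: funpow_swap1)
      qed
      ultimately show "x \<in> f -` Q m \<inter> space M"
        using measurable_space[OF f] by (auto simp: Q_def)
    qed
    moreover have "R m \<inter> Q (Suc m) = {}" by (force simp: R_def Q_def)
    ultimately show ?thesis
      using measure_preserving_measure[OF mp Q, of m] finite_measure_Union[OF R Q] by simp
  qed
  have "measure M S = (\<Sum>m<n. measure M (R m)) + measure M (Q n)" for n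
  proof (induction n)
    case 0
    have "Q 0 = S" using sets.sets_into_space[OF S(1)] by (auto simp: Q_def)
    thus ?case by simp
  next
    case (Suc n)
    thus ?case using step[of n] by simp
  qed
  hence part: "(\<Sum>m<n. measure M (R m)) \<le> measure M S" for n
    using measure_nonneg[of M "Q n"] by (metis le_add_same_cancel1)
  have disj: "disjoint_family R"
  proof -
    have "R m \<inter> R n = {}" if "m < n" for m n
      using that S(2) by (force simp: R_def simp del: funpow.simps)
    thus ?thesis unfolding disjoint_family_on_def by (metis Int_commute linorder_neqE_nat)
  qed
  have "first_return_map f A -` S \<inter> A \<subseteq> (\<Union>m. R m)"
  proof
    fix x assume x: "x \<in> first_return_map f A -` S \<inter> A"
    define n where "n = (LEAST n. 1 \<le> n \<and> (f ^^ n) x \<in> A)"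
    have "\<exists>n. 1 \<le> n \<and> (f ^^ n) x \<in> A" using x ret by (auto simp: returns_def)
    from LeastI_ex[OF this] have n: "1 \<le> n" unfolding n_def by (rule conjunct1)
    have "(f ^^ j) x \<notin> A" if "1 \<le> j" "j < n" for j
      using not_less_Least[of j "\<lambda>n. 1 \<le> n \<and> (f ^^ n) x \<in> A"] that unfolding n_def by blast
    moreover have "(f ^^ n) x \<in> S" using x by (simp add: first_return_map_def n_def)
    ultimately have "x \<in> R (n - 1)"
      using n x sets.sets_into_space[OF A] by (auto simp: R_def simp del: funpow.simps)
    thus "x \<in> (\<Union>m. R m)" by blast
  qed
  hence "measure M (first_return_map f A -` S \<inter> A) \<le> measure M (\<Union>m. R m)"
    by (rule finite_measure_mono) auto
  also have "\<dots> \<le> measure M S"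
  proof -
    have sums: "(\<lambda>m. measure M (R m)) sums measure M (\<Union>m. R m)"
      by (rule finite_measure_UNION[OF _ disj]) auto
    show ?thesis
      unfolding sums_unique[OF sums] by (rule suminf_le_const[OF sums_summable[OF sums] part])
  qed
  finally show ?thesis .
qed

text \<open>
  The inequality for a set and for its complement in \<open>A\<close> must both be equalities, as the two
  preimages partition \<open>A\<close>.
\<close>

lemma (in finite_measure) measure_preserving_first_return_map:
  assumes mp: "measure_preserving M f" and A: "A \<in> sets M" and ret: "A \<subseteq> returns f A"
  shows "measure_preserving (restrict_space M A) (first_return_map f A)"
proof -
  let ?T = "first_return_map f A"
  have f: "f \<in> measurable M M" using mp by (rule measure_preserving_measurable)
  have T: "?T \<in> measurable (restrict_space M A) (restrict_space M A)"
    by (rule measurable_first_return_map[OF f A ret])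
  have sub: "S \<in> sets M" "S \<subseteq> A" if "S \<in> sets (restrict_space M A)" for S
    using that A by (auto simp: sets_restrict_space)
  have spA: "space (restrict_space M A) = A"
    using sets.sets_into_space[OF A] by (auto simp: space_restrict_space)
  have eq: "measure M (?T -` S \<inter> A) = measure M S" if S: "S \<in> sets (restrict_space M A)" for S
  proof -
    have S': "S \<in> sets M" "S \<subseteq> A" using sub[OF S] by auto
    have "?T -` S \<inter> A \<in> sets (restrict_space M A)" using measurable_sets[OF T S] spA by simp
    hence TS: "?T -` S \<inter> A \<in> sets M" using sub by blast
    have "?T -` (A - S) \<inter> A = A - (?T -` S \<inter> A)"
      using measurable_space[OF T] spA by auto
    moreover have "measure M (?T -` (A - S) \<inter> A) \<le> measure M (A - S)"
      by (rule first_return_map_vimage_le[OF mp A ret]) (use A S' in auto)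
    moreover have "measure M (A - (?T -` S \<inter> A)) = measure M A - measure M (?T -` S \<inter> A)"
      by (rule finite_measure_Diff) (use A TS in auto)
    moreover have "measure M (A - S) = measure M A - measure M S"
      by (rule finite_measure_Diff) (use A S' in auto)
    moreover have "measure M (?T -` S \<inter> A) \<le> measure M S"
      by (rule first_return_map_vimage_le[OF mp A ret S'])
    ultimately show ?thesis by simp
  qed
  have "emeasure (restrict_space M A) (?T -` S \<inter> space (restrict_space M A)) = emeasure (restrict_space M A) S"
    if S: "S \<in> sets (restrict_space M A)" for S
    using eq[OF S] sub[OF S] A spA by (simp add: emeasure_restrict_space emeasure_eq_measure)
  thus ?thesis using T by (simp add: measure_preserving_iff)
qed

text \<open>
  An invariant set of the induced map is the trace on \<open>A\<close> of an \<open>f\<close>-invariant set, namely its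
  preimage under the entry map.
\<close>

lemma ergodic_first_return_map:
  assumes fin: "finite_measure M" and erg: "ergodic M f" and A: "A \<in> sets M" and ret: "A \<subseteq> returns f A"
  shows "ergodic (restrict_space M A) (first_return_map f A)"
proof -
  interpret finite_measure M by fact
  let ?T = "first_return_map f A"
  have mp: "measure_preserving M f" using erg by (rule ergodic_measure_preserving)
  have f: "f \<in> measurable M M" using mp by (rule measure_preserving_measurable)
  have spA: "space (restrict_space M A) = A"
    using sets.sets_into_space[OF A] by (auto simp: space_restrict_space)
  have "emeasure (restrict_space M A) S = 0 \<or> emeasure (restrict_space M A) (A - S) = 0"
    if S: "S \<in> sets (restrict_space M A)" and inv: "?T -` S \<inter> A = S" for S
  proof (cases "A = {}")
    case True
    thus ?thesis using that by (simp add: emeasure_restrict_space sets_restrict_space)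
  next
    case False
    then obtain a where a: "a \<in> A" by blast
    let ?e = "entry_map f A a"
    have S': "S \<in> sets M" "S \<subseteq> A" using S A by (auto simp: sets_restrict_space)
    define S1 where "S1 = ?e -` S \<inter> space M"
    have S1: "S1 \<in> sets M"
      unfolding S1_def by (rule measurable_sets[OF measurable_entry_map[OF f A a] S])
    have "f x \<in> S1 \<longleftrightarrow> x \<in> S1" if x: "x \<in> space M" for x
    proof (cases "x \<in> A")
      case True
      hence "?T x = ?e (f x)" using ret by (intro first_return_map_eq_entry_map) auto
      moreover have "?T x \<in> S \<longleftrightarrow> x \<in> S" using inv True by auto
      ultimately show ?thesis
        using True x measurable_space[OF f x] by (simp add: S1_def entry_map_in)
    qed (use x measurable_space[OF f x] in \<open>simp add: S1_def entry_map_step\<close>)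
    hence "emeasure M S1 = 0 \<or> emeasure M (space M - S1) = 0"
      by (intro ergodic_invariant_set[OF erg S1])
    moreover have "S \<subseteq> S1" "A - S \<subseteq> space M - S1"
      using S' sets.sets_into_space[OF A] by (auto simp: S1_def entry_map_in)
    ultimately have "emeasure M S = 0 \<or> emeasure M (A - S) = 0"
      using S1 by (metis emeasure_eq_0 sets.compl_sets)
    thus ?thesis using S' A by (simp add: emeasure_restrict_space)
  qed
  thus ?thesis
    using measure_preserving_first_return_map[OF mp A ret] spA by (simp add: ergodic_def)
qed

section \<open>Approximation by sets with piecewise constant sections\<close>

text \<open>
  The sets that can be approximated by members of an algebra form a \<open>\<sigma>\<close>-algebra.
\<close>

lemma (in finite_measure) approx_sigma_sets:
  assumes \<S>: "\<S> \<subseteq> sets M" "{} \<in> \<S>" "\<And>A. A \<in> \<S> \<Longrightarrow> space M - A \<in> \<S>"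
      "\<And>A B. A \<in> \<S> \<Longrightarrow> B \<in> \<S> \<Longrightarrow> A \<union> B \<in> \<S>"
    and G: "G \<subseteq> sets M"
      "\<And>g \<epsilon>. g \<in> G \<Longrightarrow> \<epsilon> > 0 \<Longrightarrow> \<exists>B\<in>\<S>. measure M (sym_diff g B) < \<epsilon>"
    and A: "A \<in> sigma_sets (space M) G" and \<epsilon>: "\<epsilon> > 0"
  shows "\<exists>B\<in>\<S>. measure M (sym_diff A B) < \<epsilon>"
proof -
  have sets: "A \<in> sets M" if "A \<in> sigma_sets (space M) G" for A
    using that G(1) sets.sigma_sets_subset by blast
  show ?thesis using A \<epsilon>
  proof (induction arbitrary: \<epsilon> rule: sigma_sets.induct)
    case (Basic a)
    thus ?case using G(2) by blast
  next
    case Empty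
    thus ?case using \<S>(2) by (intro bexI[of _ "{}"]) auto
  next
    case (Compl a)
    then obtain B where B: "B \<in> \<S>" "measure M (sym_diff a B) < \<epsilon>" by blast
    have "sym_diff (space M - a) (space M - B) = sym_diff a B"
      using sets.sets_into_space[OF sets[OF Compl.hyps]] sets.sets_into_space[of B M] B(1) \<S>(1) by blast
    thus ?case using B \<S>(3) by (intro bexI[of _ "space M - B"]) auto
  next
    case (Union a)
    have a: "a i \<in> sets M" for i using Union.hyps sets by blast
    define U where "U n = (\<Union>i<n. a i)" for n
    have U: "U n \<in> sets M" for n using a by (auto simp: U_def)
    have "(\<lambda>n. measure M ((\<Union>i. a i) - U n)) \<longlonglongrightarrow> measure M (\<Inter>n. (\<Union>i. a i) - U n)"
      using a U by (intro finite_Lim_measure_decseq) (fastforce simp: decseq_def U_def)+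
    also have "(\<Inter>n. (\<Union>i. a i) - U n) = {}" by (auto simp: U_def)
    finally have "\<forall>\<^sub>F n in sequentially. measure M ((\<Union>i. a i) - U n) < \<epsilon> / 2"
      using Union.prems by (intro order_tendstoD) auto
    then obtain n where n: "measure M ((\<Union>i. a i) - U n) < \<epsilon> / 2"
      using eventually_sequentially by auto
    have "\<exists>B\<in>\<S>. measure M (sym_diff (a i) B) < \<epsilon> / 2 / real (Suc n)" for i
      using Union.IH[of "\<epsilon> / 2 / real (Suc n)" i] Union.prems by simp
    then obtain B where B: "\<And>i. B i \<in> \<S>" "\<And>i. measure M (sym_diff (a i) (B i)) < \<epsilon> / 2 / real (Suc n)"
      by metis
    have Bs: "B i \<in> sets M" for i using B(1) \<S>(1) by blast
    have UB: "(\<Union>i<k. B i) \<in> \<S>" for k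
    proof (induction k)
      case (Suc k)
      have "(\<Union>i<Suc k. B i) = (\<Union>i<k. B i) \<union> B k" by (auto simp: less_Suc_eq)
      thus ?case using Suc \<S>(4) B(1) by simp
    qed (simp add: \<S>(2))
    have "sym_diff (\<Union>i. a i) (\<Union>i<n. B i) \<subseteq> ((\<Union>i. a i) - U n) \<union> (\<Union>i<n. sym_diff (a i) (B i))"
      by (auto simp: U_def)
    hence "measure M (sym_diff (\<Union>i. a i) (\<Union>i<n. B i))
        \<le> measure M (((\<Union>i. a i) - U n) \<union> (\<Union>i<n. sym_diff (a i) (B i)))"
      using a Bs U by (intro finite_measure_mono) auto
    also have "\<dots> \<le> measure M ((\<Union>i. a i) - U n) + measure M (\<Union>i<n. sym_diff (a i) (B i))"
      using a Bs U by (intro measure_Un_le) auto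
    also have "measure M (\<Union>i<n. sym_diff (a i) (B i)) \<le> (\<Sum>i<n. measure M (sym_diff (a i) (B i)))"
      using a Bs by (intro measure_UNION_le) auto
    also have "\<dots> \<le> (\<Sum>i<n. \<epsilon> / 2 / real (Suc n))"
      using B(2) by (intro sum_mono less_imp_le)
    also have "\<dots> \<le> \<epsilon> / 2" using Union.prems by (simp add: field_simps)
    finally have "measure M (sym_diff (\<Union>i. a i) (\<Union>i<n. B i)) < \<epsilon>" using n by simp
    thus ?case using UB by blast
  qed
qed

definition piecewise_const :: "real set \<Rightarrow> (real \<Rightarrow> 'a) \<Rightarrow> bool" where
  "piecewise_const X \<phi> \<longleftrightarrow>
     (\<exists>E. finite E \<and> (\<forall>x\<in>X. \<forall>x'\<in>X. x < x' \<longrightarrow> {x..x'} \<inter> E = {} \<longrightarrow> \<phi> x = \<phi> x'))"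

lemma piecewise_const_const: "piecewise_const X (\<lambda>_. c)"
  unfolding piecewise_const_def by (intro exI[of _ "{}"]) simp

lemma piecewise_const_combine:
  assumes "piecewise_const X \<phi>" "piecewise_const X \<psi>"
  shows "piecewise_const X (\<lambda>x. g (\<phi> x) (\<psi> x))"
proof -
  obtain E F where "finite E" "finite F"
    and E: "\<And>x x'. x \<in> X \<Longrightarrow> x' \<in> X \<Longrightarrow> x < x' \<Longrightarrow> {x..x'} \<inter> E = {} \<Longrightarrow> \<phi> x = \<phi> x'"
    and F: "\<And>x x'. x \<in> X \<Longrightarrow> x' \<in> X \<Longrightarrow> x < x' \<Longrightarrow> {x..x'} \<inter> F = {} \<Longrightarrow> \<psi> x = \<psi> x'"
    using assms unfolding piecewise_const_def by metis
  have "g (\<phi> x) (\<psi> x) = g (\<phi> x') (\<psi> x')"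
    if "x \<in> X" "x' \<in> X" "x < x'" "{x..x'} \<inter> (E \<union> F) = {}" for x x'
    using E[of x x'] F[of x x'] that by (simp add: Int_Un_distrib)
  thus ?thesis using \<open>finite E\<close> \<open>finite F\<close> unfolding piecewise_const_def
    by (intro exI[of _ "E \<union> F"]) blast
qed

lemma piecewise_const_cong:
  "(\<And>x. x \<in> X \<Longrightarrow> \<phi> x = \<psi> x) \<Longrightarrow> piecewise_const X \<phi> \<longleftrightarrow> piecewise_const X \<psi>"
  unfolding piecewise_const_def by auto

lemma piecewise_const_atMost: "piecewise_const X (\<lambda>x. x \<in> {..a})"
  unfolding piecewise_const_def by (intro exI[of _ "{a}"]) auto

lemma finite_measure_lebesgue_on_Ico: "finite_measure (lebesgue_on {0..<b :: real})"
proof (rule finite_measureI)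
  have "emeasure (lebesgue_on {0..<b}) {0..<b} = emeasure lebesgue {0..<b}"
    by (intro emeasure_restrict_space) auto
  also have "\<dots> = emeasure lborel {0..<b}" by simp
  also have "\<dots> \<noteq> \<infinity>" by (cases "0 \<le> b") auto
  finally show "emeasure (lebesgue_on {0..<b}) (space (lebesgue_on {0..<b})) \<noteq> \<infinity>"
    by (simp add: space_restrict_space)
qed

lemma approx_lebesgue_on_piecewise_const:
  fixes b :: real
  assumes A: "A \<in> sets (lebesgue_on {0..<b})" and \<epsilon>: "\<epsilon> > 0"
  shows "\<exists>B\<in>sets (lebesgue_on {0..<b}). piecewise_const {0..<b} (\<lambda>x. x \<in> B) \<and>
     measure (lebesgue_on {0..<b}) (sym_diff A B) < \<epsilon>"
proof -
  let ?X = "{0..<b}" and ?L = "lebesgue_on {0..<b}"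
  interpret finite_measure ?L by (rule finite_measure_lebesgue_on_Ico)
  have sp: "space ?L = ?X" by (simp add: space_restrict_space)
  have setsL: "S \<in> sets ?L \<longleftrightarrow> S \<subseteq> ?X \<and> S \<in> sets lebesgue" for S
    by (intro sets_restrict_space_iff) simp
  define \<S> where "\<S> = {B \<in> sets ?L. piecewise_const ?X (\<lambda>x. x \<in> B)}"
  define G where "G = (\<inter>) ?X ` (range (\<lambda>a::real. {..a}))"
  obtain S N N' where SN: "A = S \<union> N" "S \<in> sets borel" "N' \<in> null_sets lborel" "N \<subseteq> N'"
    using A by (auto simp: setsL elim!: sets_completionE)
  have "S \<inter> ?X = S" using A SN(1) by (auto simp: setsL)
  moreover have "S \<in> sigma_sets UNIV (range (\<lambda>a::real. {..a}))"
    using SN(2) unfolding borel_eq_atMost by simp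
  moreover have "?X \<in> sigma_sets UNIV (range (\<lambda>a::real. {..a}))"
  proof -
    have "?X \<in> sets (sigma UNIV (range (\<lambda>a::real. {..a})))" unfolding borel_eq_atMost[symmetric] by simp
    thus ?thesis by simp
  qed
  ultimately have S: "S \<in> sigma_sets ?X G"
    unfolding G_def using sigma_sets_Int[of ?X UNIV "range (\<lambda>a::real. {..a})"] by blast
  have "\<exists>B\<in>\<S>. measure ?L (sym_diff S B) < \<epsilon>"
  proof (rule approx_sigma_sets)
    show "\<S> \<subseteq> sets ?L" "{} \<in> \<S>" by (auto simp: \<S>_def piecewise_const_const)
    show "space ?L - B \<in> \<S>" if B: "B \<in> \<S>" for B
    proof -
      have "piecewise_const ?X (\<lambda>x. \<not> (x \<in> B))"
        using B piecewise_const_combine[of ?X "\<lambda>x. x \<in> B" "\<lambda>x. x \<in> B" "\<lambda>p q. \<not> p"]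
        by (simp add: \<S>_def)
      hence "piecewise_const ?X (\<lambda>x. x \<in> space ?L - B)"
        by (subst piecewise_const_cong) (auto simp: sp)
      thus ?thesis using B by (auto simp: \<S>_def)
    qed
    show "B \<union> C \<in> \<S>" if "B \<in> \<S>" "C \<in> \<S>" for B C
      using that piecewise_const_combine[of ?X "\<lambda>x. x \<in> B" "\<lambda>x. x \<in> C" "(\<or>)"]
      by (auto simp: \<S>_def)
    have GS: "g \<in> \<S>" if "g \<in> G" for g
    proof -
      from that obtain a where g: "g = ?X \<inter> {..a}" by (auto simp: G_def)
      have "piecewise_const ?X (\<lambda>x. x \<in> ?X \<inter> {..a})"
        using piecewise_const_atMost[of ?X a]
        by (subst piecewise_const_cong[of ?X _ "\<lambda>x. x \<in> {..a}"]) auto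
      thus ?thesis unfolding g \<S>_def by (auto simp: setsL)
    qed
    thus "G \<subseteq> sets ?L" by (auto simp: \<S>_def)
    show "\<exists>B\<in>\<S>. measure ?L (sym_diff g B) < e" if "g \<in> G" "e > 0" for g e
      using GS[OF that(1)] that(2) by (intro bexI[of _ g]) auto
    show "S \<in> sigma_sets (space ?L) G" using S by (simp add: sp)
  qed (rule \<epsilon>)
  then obtain B where B: "B \<in> \<S>" "measure ?L (sym_diff S B) < \<epsilon>" by blast
  have Bs: "B \<in> sets ?L" using B by (simp add: \<S>_def)
  have Ss: "S \<in> sets ?L" using A SN by (auto simp: setsL)
  have "measure ?L (sym_diff A B) \<le> measure ?L (sym_diff S B \<union> (A - S))"
    using A Bs Ss SN(1) by (intro finite_measure_mono) auto
  also have "\<dots> \<le> measure ?L (sym_diff S B) + measure ?L (A - S)"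
    using A Bs Ss by (intro measure_Un_le) auto
  also have "measure ?L (A - S) = 0"
  proof -
    have "A - S \<subseteq> ?X" using A by (auto simp: setsL)
    hence "emeasure ?L (A - S) = emeasure lebesgue (A - S)" by (intro emeasure_restrict_space) auto
    also have "\<dots> = 0"
      by (rule emeasure_eq_0[of N']) (use SN in \<open>auto simp: null_sets_def\<close>)
    finally show ?thesis by (simp add: measure_def)
  qed
  finally show ?thesis using B Bs by (intro bexI[of _ B]) (auto simp: \<S>_def)
qed

text \<open>
  Rectangles with an interval as first side are dense among measurable sets. This plays the part
  that uniform continuity of an approximating continuous function has in the scalar case: an
  interval missing finitely many points carries a single section.
\<close>

lemma approx_pair_piecewise_const:
  fixes b :: real
  assumes N: "prob_space N" and A: "A \<in> sets (lebesgue_on {0..<b} \<Otimes>\<^sub>M N)" and \<epsilon>: "\<epsilon> > 0"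
  shows "\<exists>B\<in>sets (lebesgue_on {0..<b} \<Otimes>\<^sub>M N). piecewise_const {0..<b} (\<lambda>x. Pair x -` B) \<and>
     measure (lebesgue_on {0..<b} \<Otimes>\<^sub>M N) (sym_diff A B) < \<epsilon>"
proof -
  let ?X = "{0..<b}" and ?L = "lebesgue_on {0..<b}"
  interpret N: prob_space N by fact
  interpret L: finite_measure ?L by (rule finite_measure_lebesgue_on_Ico)
  interpret P: finite_measure "?L \<Otimes>\<^sub>M N"
    by (rule finite_measure_pair_measure) unfold_locales
  have sp: "space ?L = ?X" by (simp add: space_restrict_space)
  define \<S> where "\<S> = {B \<in> sets (?L \<Otimes>\<^sub>M N). piecewise_const ?X (\<lambda>x. Pair x -` B)}"
  have "\<exists>B\<in>\<S>. measure (?L \<Otimes>\<^sub>M N) (sym_diff A B) < \<epsilon>"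
  proof (rule P.approx_sigma_sets)
    show "\<S> \<subseteq> sets (?L \<Otimes>\<^sub>M N)" "{} \<in> \<S>" by (auto simp: \<S>_def piecewise_const_const)
    show "space (?L \<Otimes>\<^sub>M N) - B \<in> \<S>" if B: "B \<in> \<S>" for B
    proof -
      have "piecewise_const ?X (\<lambda>x. space N - Pair x -` B)"
        using B piecewise_const_combine[of ?X "\<lambda>x. Pair x -` B" "\<lambda>x. Pair x -` B" "\<lambda>p q. space N - p"]
        by (simp add: \<S>_def)
      hence "piecewise_const ?X (\<lambda>x. Pair x -` (space (?L \<Otimes>\<^sub>M N) - B))"
        by (subst piecewise_const_cong[of ?X _ "\<lambda>x. space N - Pair x -` B"])
           (auto simp: sp space_pair_measure)
      thus ?thesis using B by (auto simp: \<S>_def)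
    qed
    show "B \<union> C \<in> \<S>" if "B \<in> \<S>" "C \<in> \<S>" for B C
      using that piecewise_const_combine[of ?X "\<lambda>x. Pair x -` B" "\<lambda>x. Pair x -` C" "(\<union>)"]
      by (auto simp: \<S>_def)
    show "{a \<times> c |a c. a \<in> sets ?L \<and> c \<in> sets N} \<subseteq> sets (?L \<Otimes>\<^sub>M N)" by auto
    show "A \<in> sigma_sets (space (?L \<Otimes>\<^sub>M N)) {a \<times> c |a c. a \<in> sets ?L \<and> c \<in> sets N}"
      using A by (simp only: sets_pair_measure space_pair_measure)
    show "\<exists>B\<in>\<S>. measure (?L \<Otimes>\<^sub>M N) (sym_diff g B) < e"
      if "g \<in> {a \<times> c |a c. a \<in> sets ?L \<and> c \<in> sets N}" "e > 0" for g e
    proof -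
      from that(1) obtain a c where g: "g = a \<times> c" and a: "a \<in> sets ?L" and c: "c \<in> sets N" by blast
      obtain B where B: "B \<in> sets ?L" "piecewise_const ?X (\<lambda>x. x \<in> B)" "measure ?L (sym_diff a B) < e"
        using approx_lebesgue_on_piecewise_const[OF a \<open>e > 0\<close>] by blast
      have "piecewise_const ?X (\<lambda>x. Pair x -` (B \<times> c))"
        using piecewise_const_combine[OF B(2) B(2), of "\<lambda>p q. if p then c else {}"] by simp
      hence "B \<times> c \<in> \<S>" using B(1) c by (simp add: \<S>_def)
      moreover have "measure (?L \<Otimes>\<^sub>M N) (sym_diff g (B \<times> c)) < e"
      proof -
        have "measure (?L \<Otimes>\<^sub>M N) (sym_diff g (B \<times> c)) \<le> measure (?L \<Otimes>\<^sub>M N) (sym_diff a B \<times> space N)"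
          using a B(1) c sets.sets_into_space[OF c] unfolding g
          by (intro P.finite_measure_mono) auto
        also have "\<dots> = measure ?L (sym_diff a B)"
          using a B(1) by (simp add: measure_def N.emeasure_pair_measure_Times N.emeasure_space_1)
        finally show ?thesis using B(3) by simp
      qed
      ultimately show ?thesis by blast
    qed
  qed (rule \<epsilon>)
  thus ?thesis by (auto simp: \<S>_def)
qed

text \<open>
  Markov's inequality turns approximation in the product measure into approximation of all
  sections outside a set of small measure.
\<close>

lemma sections_approx_piecewise_const:
  fixes b :: real
  assumes N: "prob_space N" and A: "A \<in> sets (lebesgue_on {0..<b} \<Otimes>\<^sub>M N)"
    and \<eta>: "\<eta> > 0" and \<delta>: "\<delta> > 0"
  obtains \<psi> where "piecewise_const {0..<b} \<psi>" "\<And>x. \<psi> x \<in> sets N"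
    "{x \<in> {0..<b}. \<eta> \<le> measure N (sym_diff (Pair x -` A) (\<psi> x))} \<in> sets (lebesgue_on {0..<b})"
    "measure (lebesgue_on {0..<b}) {x \<in> {0..<b}. \<eta> \<le> measure N (sym_diff (Pair x -` A) (\<psi> x))} < \<delta>"
proof -
  let ?X = "{0..<b}" and ?L = "lebesgue_on {0..<b}"
  interpret N: prob_space N by fact
  interpret L: finite_measure ?L by (rule finite_measure_lebesgue_on_Ico)
  interpret P: finite_measure "?L \<Otimes>\<^sub>M N"
    by (rule finite_measure_pair_measure) unfold_locales
  have sp: "space ?L = ?X" by (simp add: space_restrict_space)
  obtain B where B: "B \<in> sets (?L \<Otimes>\<^sub>M N)" "piecewise_const ?X (\<lambda>x. Pair x -` B)"
    "measure (?L \<Otimes>\<^sub>M N) (sym_diff A B) < \<eta> * \<delta>"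
    using approx_pair_piecewise_const[OF N A, of "\<eta> * \<delta>"] \<eta> \<delta> by auto
  define Z where "Z = sym_diff A B"
  have Z: "Z \<in> sets (?L \<Otimes>\<^sub>M N)" using A B(1) by (auto simp: Z_def)
  have sec: "sym_diff (Pair x -` A) (Pair x -` B) = Pair x -` Z" for x by (auto simp: Z_def)
  define Bad where "Bad = {x \<in> ?X. \<eta> \<le> measure N (sym_diff (Pair x -` A) (Pair x -` B))}"
  have meas: "(\<lambda>x. emeasure N (Pair x -` Z)) \<in> borel_measurable ?L"
    by (rule N.measurable_emeasure_Pair[OF Z])
  have Bad_eq: "Bad = {x \<in> space ?L. ennreal \<eta> \<le> emeasure N (Pair x -` Z)}"
    unfolding Bad_def sec sp using \<eta> by (simp add: N.emeasure_eq_measure)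
  have Bad: "Bad \<in> sets ?L" unfolding Bad_eq using meas by measurable
  have "ennreal \<eta> * emeasure ?L Bad = (\<integral>\<^sup>+x. ennreal \<eta> * indicator Bad x \<partial>?L)"
    using Bad by (simp add: nn_integral_cmult_indicator)
  also have "\<dots> \<le> (\<integral>\<^sup>+x. emeasure N (Pair x -` Z) \<partial>?L)"
    by (rule nn_integral_mono) (auto simp: Bad_eq indicator_def)
  also have "\<dots> = emeasure (?L \<Otimes>\<^sub>M N) Z" by (rule N.emeasure_pair_measure_alt[OF Z, symmetric])
  finally have "ennreal (\<eta> * measure ?L Bad) \<le> ennreal (measure (?L \<Otimes>\<^sub>M N) Z)"
    using \<eta> by (simp add: L.emeasure_eq_measure P.emeasure_eq_measure ennreal_mult)
  hence "\<eta> * measure ?L Bad < \<eta> * \<delta>" using B(3) by (simp add: Z_def)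
  hence "measure ?L Bad < \<delta>" using \<eta> by simp
  moreover have "Pair x -` B \<in> sets N" for x using B(1) by (rule sets_Pair1)
  ultimately show ?thesis using that[of "\<lambda>x. Pair x -` B"] B(2) Bad by (simp add: Bad_def)
qed

section \<open>Towers of intervals over a short interval\<close>

lemma translate_Ioo: "(\<lambda>x. x + t) ` {p<..<q} = {p + t<..<q + t :: real}"
proof (intro equalityI subsetI)
  fix y assume "y \<in> {p + t<..<q + t}"
  hence "y - t \<in> {p<..<q}" "y = (y - t) + t" by auto
  thus "y \<in> (\<lambda>x. x + t) ` {p<..<q}" by blast
qed auto

text \<open>
  Splitting at a point of \<open>B\<close> and recursing on the two sides gives at most one interval more than
  there are points.
\<close>

lemma gaps_of_finite_set:
  fixes u v :: real
  assumes "finite B" "u < v"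
  shows "\<exists>F. finite F \<and> card F \<le> card B + 1 \<and>
     (\<forall>(p, q)\<in>F. u \<le> p \<and> p < q \<and> q \<le> v \<and> {p<..<q} \<inter> B = {}) \<and>
     {u<..<v} - B \<subseteq> (\<Union>(p, q)\<in>F. {p<..<q})"
  using assms
proof (induction "card B" arbitrary: B u v rule: less_induct)
  case less
  show ?case
  proof (cases "B \<inter> {u<..<v} = {}")
    case True
    thus ?thesis using less.prems by (intro exI[of _ "{(u, v)}"]) auto
  next
    case False
    then obtain a where a: "a \<in> B" "u < a" "a < v" by auto
    define B1 where "B1 = B \<inter> {..<a}"
    define B2 where "B2 = B \<inter> {a<..}"
    have fin: "finite B1" "finite B2" using less.prems by (auto simp: B1_def B2_def)
    have "card B = card (B1 \<union> B2 \<union> {a})"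
      using a by (intro arg_cong[of _ _ card]) (auto simp: B1_def B2_def)
    also have "\<dots> = card (B1 \<union> B2) + card {a}"
      using fin by (intro card_Un_disjoint) (auto simp: B1_def B2_def)
    also have "card (B1 \<union> B2) = card B1 + card B2"
      using fin by (intro card_Un_disjoint) (auto simp: B1_def B2_def)
    finally have card: "card B = card B1 + card B2 + 1" by simp
    obtain F1 where F1: "finite F1" "card F1 \<le> card B1 + 1"
      "\<And>p q. (p, q) \<in> F1 \<Longrightarrow> u \<le> p \<and> p < q \<and> q \<le> a \<and> {p<..<q} \<inter> B1 = {}"
      "{u<..<a} - B1 \<subseteq> (\<Union>(p, q)\<in>F1. {p<..<q})"
    proof -
      have "card B1 < card B" "finite B1" "u < a" using card fin a by auto
      from less.hyps[OF this] show ?thesis by (elim exE conjE) (rule that, auto)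
    qed
    obtain F2 where F2: "finite F2" "card F2 \<le> card B2 + 1"
      "\<And>p q. (p, q) \<in> F2 \<Longrightarrow> a \<le> p \<and> p < q \<and> q \<le> v \<and> {p<..<q} \<inter> B2 = {}"
      "{a<..<v} - B2 \<subseteq> (\<Union>(p, q)\<in>F2. {p<..<q})"
    proof -
      have "card B2 < card B" "finite B2" "a < v" using card fin a by auto
      from less.hyps[OF this] show ?thesis by (elim exE conjE) (rule that, auto)
    qed
    show ?thesis
    proof (intro exI[of _ "F1 \<union> F2"] conjI)
      show "finite (F1 \<union> F2)" using F1 F2 by simp
      show "card (F1 \<union> F2) \<le> card B + 1"
        using card_Un_le[of F1 F2] F1(2) F2(2) card by linarith
      have 1: "u \<le> p \<and> p < q \<and> q \<le> v \<and> {p<..<q} \<inter> B = {}" if pq: "(p, q) \<in> F1" for p q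
        using F1(3)[OF pq] a by (auto simp: B1_def)
      have 2: "u \<le> p \<and> p < q \<and> q \<le> v \<and> {p<..<q} \<inter> B = {}" if pq: "(p, q) \<in> F2" for p q
        using F2(3)[OF pq] a by (auto simp: B2_def)
      show "\<forall>(p, q)\<in>F1 \<union> F2. u \<le> p \<and> p < q \<and> q \<le> v \<and> {p<..<q} \<inter> B = {}"
        using 1 2 by blast
      have "{u<..<v} - B \<subseteq> ({u<..<a} - B1) \<union> ({a<..<v} - B2)"
        using a(1) unfolding B1_def B2_def by (auto simp: not_less order_le_less)
      thus "{u<..<v} - B \<subseteq> (\<Union>(p, q)\<in>F1 \<union> F2. {p<..<q})" using F1(4) F2(4) by blast
    qed
  qed
qed

locale iet_system =
  fixes b :: real and f :: "real \<Rightarrow> real"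
  assumes iet: "iet b f"
begin

abbreviation X where "X \<equiv> {0..<b}"
abbreviation D where "D \<equiv> discontinuities b f"

lemma b_pos: "0 < b" and finite_D: "finite D"
  using iet by (auto simp: iet_def)

lemma f_in_X: "x \<in> X \<Longrightarrow> f x \<in> X"
  using iet by (auto simp: iet_def bij_betw_def)

lemma f_inj: "x \<in> X \<Longrightarrow> y \<in> X \<Longrightarrow> f x = f y \<Longrightarrow> x = y"
  using iet by (auto simp: iet_def bij_betw_def inj_on_def)

lemma funpow_in_X: "x \<in> X \<Longrightarrow> (f ^^ k) x \<in> X"
proof (induction k)
  case (Suc k)
  show ?case using f_in_X[OF Suc.IH[OF Suc.prems]] by simp
qed simp

lemma funpow_eq_cancel:
  assumes "x \<in> X" "y \<in> X" "m \<le> n" "(f ^^ m) x = (f ^^ n) y"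
  shows "x = (f ^^ (n - m)) y"
  using assms(3,4)
proof (induction m arbitrary: n)
  case (Suc m)
  then obtain n' where n: "n = Suc n'" by (cases n) auto
  have "f ((f ^^ m) x) = f ((f ^^ n') y)" using Suc.prems n by simp
  hence "(f ^^ m) x = (f ^^ n') y" using f_inj funpow_in_X assms(1,2) by blast
  thus ?case using Suc n by simp
qed simp

lemma translation_if_no_discontinuity:
  assumes "{u<..<v} \<subseteq> X" "{u<..<v} \<inter> D = {}"
  obtains t where "\<And>x. x \<in> {u<..<v} \<Longrightarrow> f x = x + t"
proof -
  have "((\<lambda>x. f x - x) has_real_derivative 0) (at x within {u<..<v})" if x: "x \<in> {u<..<v}" for x
  proof -
    have "(f has_real_derivative 1) (at x within X)"
    proof -
      have "x \<in> X - D" using x assms by blast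
      thus ?thesis using iet by (auto simp: iet_def)
    qed
    hence "(f has_real_derivative 1) (at x within {u<..<v})" by (rule DERIV_subset[OF _ assms(1)])
    from DERIV_diff[OF this DERIV_ident] show ?thesis by simp
  qed
  hence "\<exists>c. \<forall>x\<in>{u<..<v}. f x - x = c"
    by (intro has_field_derivative_zero_constant) auto
  then obtain t where "\<And>x. x \<in> {u<..<v} \<Longrightarrow> f x - x = t" by blast
  thus ?thesis by (intro that[of t]) force
qed

text \<open>
  The points of \<open>(0, c)\<close> whose orbit hits a discontinuity of \<open>f\<close> or the end point \<open>c\<close> before its
  first return to \<open>(0, c)\<close>. Only at these can the first return map to \<open>(0, c)\<close> fail to be locally a
  translation: an open interval in \<open>[0, b)\<close> never contains \<open>0\<close>, so it can straddle the boundary of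
  \<open>(0, c)\<close> only at \<open>c\<close>.
\<close>

definition preimages_of_breaks :: "real \<Rightarrow> real set" where
  "preimages_of_breaks c = {x \<in> {0<..<c}.
     \<exists>k. (\<forall>j\<in>{1..k}. (f ^^ j) x \<notin> {0<..<c}) \<and> (f ^^ k) x \<in> insert c D}"

text \<open>
  The break that is hit determines the point: it is the first point of \<open>(0, c)\<close> met on the
  backward orbit of that break.
\<close>

lemma finite_preimages_of_breaks:
  assumes "c \<le> b"
  shows "finite (preimages_of_breaks c)" "card (preimages_of_breaks c) \<le> card D + 1"
proof -
  let ?B = "preimages_of_breaks c"
  have "\<forall>x\<in>?B. \<exists>k. (\<forall>j\<in>{1..k}. (f ^^ j) x \<notin> {0<..<c}) \<and> (f ^^ k) x \<in> insert c D"
    by (auto simp: preimages_of_breaks_def)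
  then obtain k where k: "\<And>x j. x \<in> ?B \<Longrightarrow> j \<in> {1..k x} \<Longrightarrow> (f ^^ j) x \<notin> {0<..<c}"
    "\<And>x. x \<in> ?B \<Longrightarrow> (f ^^ k x) x \<in> insert c D" by metis
  have BX: "x \<in> X" "x \<in> {0<..<c}" if "x \<in> ?B" for x
    using that assms by (auto simp: preimages_of_breaks_def)
  have le: "x = y" if "x \<in> ?B" "y \<in> ?B" "k x \<le> k y" "(f ^^ k x) x = (f ^^ k y) y" for x y
  proof -
    have x: "x = (f ^^ (k y - k x)) y" using that BX by (intro funpow_eq_cancel) auto
    have "k y - k x \<notin> {1..k y}" using k(1)[of y "k y - k x"] that BX(2)[of x] x by auto
    hence "k y - k x = 0" by auto
    thus ?thesis using x by simp
  qed
  have inj: "inj_on (\<lambda>x. (f ^^ k x) x) ?B"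
  proof (rule inj_onI)
    fix x y assume "x \<in> ?B" "y \<in> ?B" "(f ^^ k x) x = (f ^^ k y) y"
    thus "x = y" using le[of x y] le[of y x] by (cases "k x \<le> k y") auto
  qed
  have sub: "(\<lambda>x. (f ^^ k x) x) ` ?B \<subseteq> insert c D" using k(2) by blast
  have fin: "finite (insert c D)" using finite_D by simp
  show "finite ?B" by (rule inj_on_finite[OF inj sub fin])
  have "card ?B \<le> card (insert c D)" by (rule card_inj_on_le[OF inj sub fin])
  also have "\<dots> \<le> card D + 1" using finite_D by (simp add: card_insert_if)
  finally show "card ?B \<le> card D + 1" .
qed

text \<open>
  Until its first return, the image of the interval is an open interval disjoint from \<open>(0, c)\<close> that
  contains no discontinuity, hence is translated as a whole. It does return, because the images
  would otherwise be infinitely many disjoint intervals of equal length. When it meets \<open>(0, c)\<close> it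
  lies inside, since it contains neither end point.
\<close>

lemma first_return_translation:
  assumes c: "c \<le> b" and pq: "0 \<le> p" "p < q" "q \<le> c"
    and gap: "{p<..<q} \<inter> preimages_of_breaks c = {}"
  obtains h s where "h \<ge> 1" "\<And>k x. k \<le> h \<Longrightarrow> x \<in> {p<..<q} \<Longrightarrow> (f ^^ k) x = x + s k"
    "\<And>k x. k \<in> {1..<h} \<Longrightarrow> x \<in> {p<..<q} \<Longrightarrow> (f ^^ k) x \<notin> {0<..<c}"
    "\<And>x. x \<in> {p<..<q} \<Longrightarrow> (f ^^ h) x \<in> {0<..<c}"
proof -
  let ?I = "{p<..<q}"
  have IX: "x \<in> X" "x \<in> {0<..<c}" if "x \<in> ?I" for x using that pq c by auto
  define Tr where "Tr k \<longleftrightarrow> (\<exists>t. \<forall>x\<in>?I. (f ^^ k) x = x + t)" for k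
  define NR where "NR k \<longleftrightarrow> (\<forall>j\<in>{1..k}. \<forall>x\<in>?I. (f ^^ j) x \<notin> {0<..<c})" for k
  have avoid: "(f ^^ k) x \<notin> insert c D" if "x \<in> ?I" "\<forall>j\<in>{1..k}. (f ^^ j) x \<notin> {0<..<c}" for x k
    using gap that IX[OF that(1)] unfolding preimages_of_breaks_def by blast
  have step: "Tr (Suc k) \<and> ((\<forall>x\<in>?I. (f ^^ Suc k) x \<notin> {0<..<c}) \<or> (\<forall>x\<in>?I. (f ^^ Suc k) x \<in> {0<..<c}))"
    if tr: "Tr k" and nr: "NR k" for k
  proof -
    obtain t where t: "\<And>x. x \<in> ?I \<Longrightarrow> (f ^^ k) x = x + t" using tr by (auto simp: Tr_def)
    have lev: "y - t \<in> ?I" "(f ^^ k) (y - t) = y" if "y \<in> {p + t<..<q + t}" for y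
      using that t[of "y - t"] by auto
    have sub: "{p + t<..<q + t} \<subseteq> X"
    proof
      fix y assume y: "y \<in> {p + t<..<q + t}"
      show "y \<in> X" using funpow_in_X[OF IX(1)[OF lev(1)[OF y]], of k] unfolding lev(2)[OF y] .
    qed
    have "{p + t<..<q + t} \<inter> D = {}"
    proof -
      have "y \<notin> D" if y: "y \<in> {p + t<..<q + t}" for y
        using avoid[OF lev(1)[OF y], of k] nr lev[OF y] unfolding NR_def by auto
      thus ?thesis by blast
    qed
    then obtain t' where t': "\<And>x. x \<in> {p + t<..<q + t} \<Longrightarrow> f x = x + t'"
      using translation_if_no_discontinuity[OF sub] by blast
    have tt: "(f ^^ Suc k) x = x + (t + t')" if "x \<in> ?I" for x
      using t[OF that] t'[of "x + t"] that by simp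
    have pos: "(f ^^ Suc k) x > 0" if x: "x \<in> ?I" for x
    proof -
      have m: "(p + x) / 2 \<in> ?I" "(p + x) / 2 < x" using x by auto
      have "(f ^^ Suc k) ((p + x) / 2) \<ge> 0" using funpow_in_X[OF IX(1)[OF m(1)], of "Suc k"] by auto
      thus ?thesis using m(2) unfolding tt[OF m(1)] tt[OF x] by linarith
    qed
    have not_c: "(f ^^ Suc k) x \<noteq> c" if x: "x \<in> ?I" for x
    proof
      assume eq: "(f ^^ Suc k) x = c"
      have "\<forall>j\<in>{1..Suc k}. (f ^^ j) x \<notin> {0<..<c}"
      proof
        fix j assume j: "j \<in> {1..Suc k}"
        show "(f ^^ j) x \<notin> {0<..<c}"
          using nr x j eq unfolding NR_def by (cases "j = Suc k") auto
      qed
      from avoid[OF x this] eq show False by simp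
    qed
    have "(\<forall>x\<in>?I. (f ^^ Suc k) x \<in> {0<..<c})" if x: "x \<in> ?I" "(f ^^ Suc k) x \<in> {0<..<c}" for x
    proof
      fix y assume y: "y \<in> ?I"
      show "(f ^^ Suc k) y \<in> {0<..<c}"
      proof (rule ccontr)
        assume "\<not> ?thesis"
        hence "c \<le> y + (t + t')" using pos[OF y] tt[OF y] by auto
        moreover have "x + (t + t') < c" using x tt[OF x(1)] by auto
        ultimately have z: "c - (t + t') \<in> ?I" using x(1) y by auto
        show False using not_c[OF z] tt[OF z] by simp
      qed
    qed
    thus ?thesis using tt unfolding Tr_def by blast
  qed
  have up: "Tr n \<and> NR n" if "\<And>k x. k \<in> {1..n} \<Longrightarrow> x \<in> ?I \<Longrightarrow> (f ^^ k) x \<notin> {0<..<c}" for n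
    using that
  proof (induction n)
    case 0
    thus ?case by (auto simp: Tr_def NR_def intro!: exI[of _ 0])
  next
    case (Suc n)
    hence "Tr n" "NR n" by auto
    from step[OF this] show ?case using Suc.prems unfolding NR_def by auto
  qed
  have "\<exists>h. 1 \<le> h \<and> (\<exists>x\<in>?I. (f ^^ h) x \<in> {0<..<c})"
  proof (rule ccontr)
    assume no: "\<not> ?thesis"
    have all: "Tr n" for n using up[of n] no by auto
    define m where "m = (p + q) / 2"
    have m: "m \<in> ?I" using pq by (auto simp: m_def)
    have im: "(f ^^ k) ` ?I = {p + ((f ^^ k) m - m)<..<q + ((f ^^ k) m - m)}" for k
    proof -
      obtain t where t: "\<And>x. x \<in> ?I \<Longrightarrow> (f ^^ k) x = x + t" using all[of k] by (auto simp: Tr_def)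
      hence "(f ^^ k) ` ?I = (\<lambda>x. x + t) ` ?I" by (intro image_cong) auto
      also have "\<dots> = {p + t<..<q + t}" by (rule translate_Ioo)
      finally show ?thesis using t[OF m] by simp
    qed
    have dj: "(f ^^ j) ` ?I \<inter> (f ^^ k) ` ?I = {}" if "j < k" for j k
    proof (rule ccontr)
      assume "(f ^^ j) ` ?I \<inter> (f ^^ k) ` ?I \<noteq> {}"
      then obtain x y where xy: "x \<in> ?I" "y \<in> ?I" "(f ^^ j) x = (f ^^ k) y" by blast
      hence "x = (f ^^ (k - j)) y" using that IX by (intro funpow_eq_cancel) auto
      thus False using no xy that IX(2)[OF xy(1)] by (auto dest!: spec[of _ "k - j"])
    qed
    have dj': "disjoint_family_on (\<lambda>k. (f ^^ k) ` ?I) {..<n}" for n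
      unfolding disjoint_family_on_def using dj by (metis Int_commute linorder_neqE_nat)
    have "real n * (q - p) \<le> b" for n
    proof -
      have "(\<Union>k<n. (f ^^ k) ` ?I) \<subseteq> X" using funpow_in_X IX by blast
      hence "measure lborel (\<Union>k<n. (f ^^ k) ` ?I) \<le> measure lborel X"
        using b_pos by (intro measure_mono_fmeasurable) (auto simp: im fmeasurable_def)
      also have "measure lborel (\<Union>k<n. (f ^^ k) ` ?I) = (\<Sum>k<n. measure lborel ((f ^^ k) ` ?I))"
        by (rule measure_finite_Union) (use dj' pq in \<open>auto simp: im\<close>)
      also have "\<dots> = real n * (q - p)" using pq by (simp add: im)
      finally show ?thesis using b_pos by simp
    qed
    moreover obtain n :: nat where "b / (q - p) < real n" using reals_Archimedean2 by blast
    ultimately show False using pq by (simp add: divide_simps) (meson not_less)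
  qed
  define h where "h = (LEAST h. 1 \<le> h \<and> (\<exists>x\<in>?I. (f ^^ h) x \<in> {0<..<c}))"
  have h: "1 \<le> h" "\<exists>x\<in>?I. (f ^^ h) x \<in> {0<..<c}"
    using LeastI_ex[OF \<open>\<exists>h. 1 \<le> h \<and> _\<close>] unfolding h_def by blast+
  have before: "(f ^^ k) x \<notin> {0<..<c}" if "k \<in> {1..<h}" "x \<in> ?I" for k x
    using not_less_Least[of k "\<lambda>h. 1 \<le> h \<and> (\<exists>x\<in>?I. (f ^^ h) x \<in> {0<..<c})"] that
    unfolding h_def by auto
  have TN: "Tr k \<and> NR k" if "k < h" for k
    by (rule up) (use before that in auto)
  have last: "Tr h" "\<forall>x\<in>?I. (f ^^ h) x \<in> {0<..<c}"
  proof -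
    have "Suc (h - 1) = h" using h by simp
    thus "Tr h" "\<forall>x\<in>?I. (f ^^ h) x \<in> {0<..<c}"
      using step[of "h - 1"] TN[of "h - 1"] h by auto
  qed
  have "Tr k" if "k \<le> h" for k
    using TN[of k] last(1) that by (cases "k = h") auto
  hence "\<forall>k. \<exists>t. k \<le> h \<longrightarrow> (\<forall>x\<in>?I. (f ^^ k) x = x + t)" unfolding Tr_def by blast
  from choice[OF this] obtain s where s: "\<forall>k. k \<le> h \<longrightarrow> (\<forall>x\<in>?I. (f ^^ k) x = x + s k)" ..
  show ?thesis
    by (rule that[of h s]) (use h(1) s before last(2) in blast)+
qed

text \<open>
  Every point, including the exceptional ones, is the left end point of an interval to which
  \<open>first_return_translation\<close> applies, and by right continuity the point follows that interval.
\<close>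

lemma initial_interval_returns:
  assumes c: "c \<le> b"
  shows "{0..<c} \<subseteq> returns f {0..<c}"
proof
  fix x assume x: "x \<in> {0..<c}"
  let ?B = "preimages_of_breaks c"
  obtain q where q: "x < q" "q \<le> c" "{x<..<q} \<inter> ?B = {}"
  proof (cases "?B \<inter> {x<..} = {}")
    case True
    hence "{x<..<c} \<inter> ?B = {}" by fastforce
    thus ?thesis using that[of c] x by simp
  next
    case False
    define q where "q = min c (Min (?B \<inter> {x<..}))"
    have fin: "finite (?B \<inter> {x<..})" using finite_preimages_of_breaks[OF c] by simp
    show ?thesis
    proof (rule that[of q])
      show "x < q" using Min_in[OF fin False] x by (auto simp: q_def)
      show "{x<..<q} \<inter> ?B = {}" using Min_le[OF fin] by (fastforce simp: q_def)
    qed (simp add: q_def)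
  qed
  obtain h s where hs: "h \<ge> 1" "\<And>k y. k \<le> h \<Longrightarrow> y \<in> {x<..<q} \<Longrightarrow> (f ^^ k) y = y + s k"
    "\<And>y. y \<in> {x<..<q} \<Longrightarrow> (f ^^ h) y \<in> {0<..<c}"
    using first_return_translation[OF c _ q] x by (metis atLeastLessThan_iff)
  have xX: "x \<in> X" using x c by auto
  have "(f ^^ k) x = x + s k" if "k \<le> h" for k
    using that
  proof (induction k)
    case 0
    have "(x + q) / 2 \<in> {x<..<q}" using q by auto
    from hs(2)[OF _ this, of 0] show ?case by simp
  next
    case (Suc k)
    define z where "z = x + s k"
    have z: "(f ^^ k) x = z" using Suc by (simp add: z_def)
    have lim: "(f \<longlongrightarrow> f z) (at_right z)"
      using iet funpow_in_X[OF xX, of k] unfolding z iet_def continuous_within by blast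
    have "\<forall>\<^sub>F y in at_right z. f y = y + (s (Suc k) - s k)"
    proof -
      have "\<forall>\<^sub>F y in at_right z. y \<in> {z<..<z + (q - x)}"
        using q by (intro eventually_at_right_real) auto
      thus ?thesis
      proof eventually_elim
        case (elim y)
        have y: "y - s k \<in> {x<..<q}" using elim by (auto simp: z_def)
        have "f ((f ^^ k) (y - s k)) = y - s k + s (Suc k)"
          using hs(2)[OF Suc.prems y] by simp
        moreover have "(f ^^ k) (y - s k) = y" using hs(2)[of k, OF _ y] Suc.prems by simp
        ultimately show ?case by simp
      qed
    qed
    hence "(f \<longlongrightarrow> z + (s (Suc k) - s k)) (at_right z)"
      by (subst tendsto_cong) (auto intro!: tendsto_intros)
    with lim have "f z = z + (s (Suc k) - s k)"
      using tendsto_unique trivial_limit_at_right_real by blast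
    thus ?case using z by (simp add: z_def)
  qed
  hence fh: "(f ^^ h) x = x + s h" by simp
  have "(x + q) / 2 \<in> {x<..<q}" using q by auto
  from hs(3)[OF this] hs(2)[OF order_refl this] have "(x + q) / 2 + s h < c" by simp
  hence aux: "(x + q) / 2 + s h < c" "x < (x + q) / 2" using q(1) by auto
  have "x + s h < c" using add_strict_right_mono[OF aux(2), of "s h"] aux(1) by (rule less_trans)
  moreover have "0 \<le> (f ^^ h) x" using funpow_in_X[OF xX, of h] by auto
  ultimately have "(f ^^ h) x \<in> {0..<c}" using fh by auto
  thus "x \<in> returns f {0..<c}" using hs(1) by (auto simp: returns_def)
qed

text \<open>
  The levels over the base \<open>{u<..<v}\<close> are pairwise disjoint translates, the displacement of the
  level \<open>k\<close> being \<open>s k\<close>.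
\<close>

definition tower :: "real \<Rightarrow> real \<Rightarrow> nat \<Rightarrow> (nat \<Rightarrow> real) \<Rightarrow> bool" where
  "tower u v h s \<longleftrightarrow> u < v \<and> {u<..<v} \<subseteq> X \<and>
     (\<forall>k<h. \<forall>x\<in>{u<..<v}. (f ^^ k) x = x + s k) \<and>
     (\<forall>j<h. \<forall>k<h. j \<noteq> k \<longrightarrow> {u + s j<..<v + s j} \<inter> {u + s k<..<v + s k} = {})"

lemma tower_level_eq:
  assumes "tower u v h s" "k < h" "u \<le> u'" "v' \<le> v"
  shows "(f ^^ k) ` {u'<..<v'} = {u' + s k<..<v' + s k}"
proof -
  have "(f ^^ k) x = x + s k" if "x \<in> {u'<..<v'}" for x
  proof -
    have "x \<in> {u<..<v}" using that assms(3,4) by auto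
    thus ?thesis using assms(1,2) unfolding tower_def by blast
  qed
  hence "(f ^^ k) ` {u'<..<v'} = (\<lambda>x. x + s k) ` {u'<..<v'}" by (rule image_cong[OF refl])
  also have "\<dots> = {u' + s k<..<v' + s k}" by (rule translate_Ioo)
  finally show ?thesis .
qed

lemma tower_level_subset:
  assumes "tower u v h s" "k < h"
  shows "{u + s k<..<v + s k} \<subseteq> X"
proof -
  have "(f ^^ k) ` {u<..<v} \<subseteq> X" using assms(1) funpow_in_X unfolding tower_def by blast
  thus ?thesis unfolding tower_level_eq[OF assms order_refl order_refl] .
qed

end

locale ergodic_iet = iet_system +
  assumes erg: "ergodic (lebesgue_on {0..<b}) f"
begin

abbreviation L where "L \<equiv> lebesgue_on {0..<b}"

lemma space_L: "space L = X"
  by (simp add: space_restrict_space)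

lemma sets_L_iff: "S \<in> sets L \<longleftrightarrow> S \<subseteq> X \<and> S \<in> sets lebesgue"
  by (intro sets_restrict_space_iff) simp

lemma emeasure_L: "S \<subseteq> X \<Longrightarrow> emeasure L S = emeasure lebesgue S"
  by (intro emeasure_restrict_space) auto

lemma emeasure_L_X: "emeasure L X = ennreal b"
  using b_pos by (simp add: emeasure_L)

sublocale finite_measure L
  by (rule finite_measure_lebesgue_on_Ico)

lemma measure_L_X: "measure L X = b"
  using b_pos by (simp add: measure_def emeasure_L_X)

lemma Ioo_in_sets_L: "{p<..<q} \<subseteq> X \<Longrightarrow> {p<..<q} \<in> sets L"
  by (simp add: sets_L_iff)

lemma measure_L_Ioo: "p \<le> q \<Longrightarrow> {p<..<q} \<subseteq> X \<Longrightarrow> measure L {p<..<q} = q - p"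
  by (simp add: measure_def emeasure_L)

lemma emeasure_L_finite_set: "finite B \<Longrightarrow> B \<subseteq> X \<Longrightarrow> B \<in> sets L \<and> emeasure L B = 0"
  by (simp add: sets_L_iff emeasure_L emeasure_lborel_countable finite_imp_closed countable_finite)

lemma mp: "measure_preserving L f"
  using erg by (rule ergodic_measure_preserving)

lemma f_measurable: "f \<in> measurable L L"
  using mp by (rule measure_preserving_measurable)

lemma tower_of_first_return:
  assumes pq: "p < q" "{p<..<q} \<subseteq> {0<..<c}" "c \<le> b"
    and tr: "\<And>k x. k < h \<Longrightarrow> x \<in> {p<..<q} \<Longrightarrow> (f ^^ k) x = x + s k"
    and out: "\<And>k x. k \<in> {1..<h} \<Longrightarrow> x \<in> {p<..<q} \<Longrightarrow> (f ^^ k) x \<notin> {0<..<c}"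
  shows "tower p q h s"
proof -
  have disj: "{p + s j<..<q + s j} \<inter> {p + s k<..<q + s k} = {}" if jk: "j < k" "k < h" for j k
  proof (rule ccontr)
    assume "{p + s j<..<q + s j} \<inter> {p + s k<..<q + s k} \<noteq> {}"
    then obtain y where "y \<in> {p + s j<..<q + s j}" "y \<in> {p + s k<..<q + s k}" by blast
    hence y: "y - s j \<in> {p<..<q}" "y - s k \<in> {p<..<q}" by auto
    have "(f ^^ j) (y - s j) = (f ^^ k) (y - s k)"
      using tr[OF _ y(1), of j] tr[OF _ y(2), of k] jk by simp
    moreover have "y - s j \<in> X" "y - s k \<in> X" using y pq(2,3) by (auto simp: subset_iff)
    ultimately have "y - s j = (f ^^ (k - j)) (y - s k)"
      using jk by (intro funpow_eq_cancel) auto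
    moreover have "(f ^^ (k - j)) (y - s k) \<notin> {0<..<c}" using jk y(2) by (intro out) auto
    ultimately show False using y(1) pq(2) by auto
  qed
  have "{p + s j<..<q + s j} \<inter> {p + s k<..<q + s k} = {}" if "j < h" "k < h" "j \<noteq> k" for j k
    using disj[of j k] disj[of k j] that by (cases "j < k") auto
  moreover have "{p<..<q} \<subseteq> X" using pq(2,3) by force
  ultimately show ?thesis using pq(1) tr unfolding tower_def by blast
qed

text \<open>
  The towers over the continuity intervals of the first return map to \<open>(0, c)\<close> can only be left into
  the finite set of break preimages, so by ergodicity their union has full measure \<open>b\<close>. As there are
  at most \<open>card D + 2\<close> of them, one has at least the average measure.
\<close>

lemma large_tower_exists:
  assumes c: "0 < c" "c \<le> b"
  shows "\<exists>u v h s. tower u v h s \<and> v - u \<le> c \<and> b / (card D + 2) \<le> real h * (v - u)"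
proof -
  let ?B = "preimages_of_breaks c"
  note finB = finite_preimages_of_breaks[OF c(2)]
  from gaps_of_finite_set[OF finB(1) c(1)] obtain F where F: "finite F" "card F \<le> card ?B + 1"
    and F': "\<forall>g\<in>F. 0 \<le> fst g \<and> fst g < snd g \<and> snd g \<le> c \<and> {fst g<..<snd g} \<inter> ?B = {}"
    and cov: "{0<..<c} - ?B \<subseteq> (\<Union>g\<in>F. {fst g<..<snd g})"
    by (auto simp: split_beta)
  define P where "P g h s \<longleftrightarrow> h \<ge> 1 \<and>
      (\<forall>k x. k \<le> h \<longrightarrow> x \<in> {fst g<..<snd g} \<longrightarrow> (f ^^ k) x = x + s k) \<and>
      (\<forall>k x. k \<in> {1..<h} \<longrightarrow> x \<in> {fst g<..<snd g} \<longrightarrow> (f ^^ k) x \<notin> {0<..<c}) \<and>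
      (\<forall>x. x \<in> {fst g<..<snd g} \<longrightarrow> (f ^^ h) x \<in> {0<..<c})" for g h s
  have "\<forall>g\<in>F. \<exists>h s. P g h s"
  proof
    fix g assume g: "g \<in> F"
    have g': "0 \<le> fst g" "fst g < snd g" "snd g \<le> c" "{fst g<..<snd g} \<inter> ?B = {}"
      using F' g by auto
    show "\<exists>h s. P g h s"
      by (rule first_return_translation[OF c(2) g']) (unfold P_def, blast)
  qed
  then obtain h s where hs: "\<And>g. g \<in> F \<Longrightarrow> P g (h g) (s g)" by metis
  have tow: "tower (fst g) (snd g) (h g) (s g)" if g: "g \<in> F" for g
  proof (rule tower_of_first_return[of _ _ c])
    show "fst g < snd g" "{fst g<..<snd g} \<subseteq> {0<..<c}" using F' g by auto
  qed (use hs[OF g] c in \<open>auto simp: P_def\<close>)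
  define lev where "lev g k = {fst g + s g k<..<snd g + s g k}" for g k
  define W where "W = (\<Union>g\<in>F. \<Union>k<h g. lev g k)"
  have lev_eq: "lev g k = (f ^^ k) ` {fst g<..<snd g}" if "g \<in> F" "k < h g" for g k
    using tower_level_eq[OF tow[OF that(1)] that(2) order_refl order_refl] by (simp add: lev_def)
  have lev_X: "lev g k \<subseteq> X" if "g \<in> F" "k < h g" for g k
    using tower_level_subset[OF tow[OF that(1)] that(2)] by (simp add: lev_def)
  have lev_sets: "lev g k \<in> sets L" if "g \<in> F" "k < h g" for g k
    using lev_X[OF that] unfolding lev_def by (rule Ioo_in_sets_L)
  have W: "W \<in> sets L" unfolding W_def using lev_sets F(1) by (intro sets.finite_UN) auto
  have BX: "?B \<subseteq> X" using c by (auto simp: preimages_of_breaks_def)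
  note nullB = emeasure_L_finite_set[OF finB(1) BX]
  have base: "{fst g<..<snd g} \<subseteq> W" if g: "g \<in> F" for g
  proof -
    have "0 < h g" using hs[OF g] by (auto simp: P_def)
    thus ?thesis using lev_eq[OF g, of 0] g unfolding W_def by (simp, blast)
  qed
  have exit: "W - f -` W \<subseteq> f -` ?B \<inter> space L"
  proof
    fix x assume x: "x \<in> W - f -` W"
    then obtain g k where gk: "g \<in> F" "k < h g" "x \<in> lev g k" unfolding W_def by blast
    then obtain y where y: "y \<in> {fst g<..<snd g}" "x = (f ^^ k) y" using lev_eq by auto
    have fx: "f x = (f ^^ Suc k) y" using y by simp
    have "Suc k = h g"
    proof (rule ccontr)
      assume "Suc k \<noteq> h g"
      hence k: "Suc k < h g" using gk by simp
      have "f x \<in> lev g (Suc k)" using lev_eq[OF gk(1) k] y(1) fx by blast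
      hence "f x \<in> W" using gk(1) k unfolding W_def by blast
      thus False using x by simp
    qed
    hence "f x \<in> {0<..<c}" using hs[OF gk(1)] y(1) fx unfolding P_def by metis
    moreover have "f x \<notin> W" using x by simp
    ultimately have "f x \<in> ?B" using cov base by blast
    moreover have "x \<in> space L" using W x sets.sets_into_space by blast
    ultimately show "x \<in> f -` ?B \<inter> space L" by (intro IntI vimageI2)
  qed
  have "f -` ?B \<inter> space L \<in> sets L"
    using nullB by (intro measurable_sets[OF f_measurable]) blast
  moreover have "emeasure L (f -` ?B \<inter> space L) = 0"
    using measure_preserving_emeasure[OF mp, of ?B] nullB by metis
  ultimately have "emeasure L (W - f -` W) = 0" using exit by (rule emeasure_eq_0)
  hence dich: "emeasure L W = 0 \<or> emeasure L (space L - W) = 0"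
    by (rule ergodic_almost_forward_invariant_set[OF erg W])
  have "F \<noteq> {}"
  proof
    assume "F = {}"
    hence "{0<..<c} \<subseteq> ?B" using cov by simp
    hence "finite {0<..<c}" using finB(1) finite_subset by blast
    thus False using c(1) infinite_Ioo by blast
  qed
  then obtain g0 where g0: "g0 \<in> F" by blast
  have "emeasure L W \<noteq> 0"
  proof
    assume "emeasure L W = 0"
    hence "measure L {fst g0<..<snd g0} \<le> 0"
      using finite_measure_mono[OF base[OF g0] W] by (simp add: measure_def)
    moreover have "measure L {fst g0<..<snd g0} = snd g0 - fst g0"
      using F' g0 c by (intro measure_L_Ioo) auto
    ultimately show False using F' g0 by auto
  qed
  hence full: "measure L W = b"
    using dich finite_measure_compl[OF W] by (simp add: measure_def space_L emeasure_L_X measure_L_X)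
       (use b_pos in simp)
  have W_le: "measure L W \<le> (\<Sum>g\<in>F. real (h g) * (snd g - fst g))"
  proof -
    have "measure L W \<le> (\<Sum>g\<in>F. measure L (\<Union>k<h g. lev g k))"
      unfolding W_def using F(1) lev_sets by (intro measure_UNION_le sets.finite_UN) auto
    also have "\<dots> \<le> (\<Sum>g\<in>F. \<Sum>k<h g. measure L (lev g k))"
      using lev_sets by (intro sum_mono measure_UNION_le) auto
    also have "\<dots> = (\<Sum>g\<in>F. \<Sum>k<h g. snd g - fst g)"
    proof (intro sum.cong refl)
      fix g k assume gk: "g \<in> F" "k \<in> {..<h g}"
      have "fst g + s g k \<le> snd g + s g k" using F' gk(1) by auto
      thus "measure L (lev g k) = snd g - fst g"
        using lev_X[of g k] gk unfolding lev_def by (subst measure_L_Ioo) auto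
    qed
    finally show ?thesis by simp
  qed
  have "\<exists>g\<in>F. b / (card D + 2) \<le> real (h g) * (snd g - fst g)"
  proof (rule ccontr)
    assume "\<not> ?thesis"
    hence "(\<Sum>g\<in>F. real (h g) * (snd g - fst g)) < (\<Sum>g\<in>F. b / (card D + 2))"
      using F(1) \<open>F \<noteq> {}\<close> by (intro sum_strict_mono) (auto simp: not_le)
    also have "\<dots> = real (card F) * (b / (card D + 2))" by simp
    also have "\<dots> \<le> real (card D + 2) * (b / (card D + 2))"
      using F(2) finB(2) b_pos by (intro mult_right_mono) auto
    also have "\<dots> = b" by simp
    finally show False using W_le full by simp
  qed
  then obtain g where g: "g \<in> F" "b / (card D + 2) \<le> real (h g) * (snd g - fst g)" by blast
  moreover have "snd g - fst g \<le> c" using F' g(1) by force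
  ultimately show ?thesis using tow by blast
qed

section \<open>Points in the cores of infinitely many towers\<close>

text \<open>
  The middle halves of the levels in the middle half of the tower. A point of the core leaves
  proportional parts of its level on both sides, and proportional numbers of levels below and above.
\<close>

definition core :: "real \<Rightarrow> real \<Rightarrow> nat \<Rightarrow> (nat \<Rightarrow> real) \<Rightarrow> real set" where
  "core u v h s = (\<Union>k\<in>{k. h \<le> 4 * k \<and> 4 * k < 3 * h}. {3 / 4 * u + 1 / 4 * v + s k<..<1 / 4 * u + 3 / 4 * v + s k})"

lemma core_levels: "{k. h \<le> 4 * k \<and> 4 * k < 3 * h} = {(h + 3) div 4..<(3 * h + 3) div 4}" for h :: nat
  by auto

lemma open_core: "open (core u v h s)"
  by (auto simp: core_def)

lemma core_level_subset:
  "u < v \<Longrightarrow> {3 / 4 * u + 1 / 4 * v + a<..<1 / 4 * u + 3 / 4 * v + a} \<subseteq> {u + a<..<v + a}" for u v a :: real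
  by (intro subsetI, simp only: greaterThanLessThan_iff) linarith

lemma core_subset_X: "tower u v h s \<Longrightarrow> core u v h s \<subseteq> X"
proof -
  assume t: "tower u v h s"
  have "{3 / 4 * u + 1 / 4 * v + s k<..<1 / 4 * u + 3 / 4 * v + s k} \<subseteq> X" if "4 * k < 3 * h" for k
    using core_level_subset[of u v "s k"] tower_level_subset[OF t, of k] t that
    by (auto simp: tower_def)
  thus ?thesis unfolding core_def by blast
qed

lemma core_in_sets_L: "tower u v h s \<Longrightarrow> core u v h s \<in> sets L"
  using core_subset_X open_core by (auto simp: sets_L_iff)

lemma measure_core_ge:
  assumes t: "tower u v h s"
  shows "(2 * real h * (v - u) - 3 * (v - u)) / 8 \<le> measure L (core u v h s)"
proof -
  let ?K = "{(h + 3) div 4..<(3 * h + 3) div 4}"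
  let ?I = "\<lambda>k. {3 / 4 * u + 1 / 4 * v + s k<..<1 / 4 * u + 3 / 4 * v + s k}"
  have uv: "u < v" using t by (simp add: tower_def)
  have K: "k < h" if "k \<in> ?K" for k using that by auto
  have sub: "?I k \<subseteq> {u + s k<..<v + s k}" for k by (rule core_level_subset[OF uv])
  have IX: "?I k \<subseteq> X" if "k \<in> ?K" for k
    using sub[of k] tower_level_subset[OF t K[OF that]] by blast
  have disj: "disjoint_family_on ?I ?K"
    unfolding disjoint_family_on_def
  proof (intro ballI impI)
    fix j k assume "j \<in> ?K" "k \<in> ?K" "j \<noteq> k"
    hence "{u + s j<..<v + s j} \<inter> {u + s k<..<v + s k} = {}"
      using t K by (auto simp: tower_def)
    thus "?I j \<inter> ?I k = {}" using sub[of j] sub[of k] by blast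
  qed
  have "core u v h s = (\<Union>k\<in>?K. ?I k)" unfolding core_def core_levels ..
  hence "measure L (core u v h s) = (\<Sum>k\<in>?K. measure L (?I k))"
    using IX Ioo_in_sets_L by (simp only:) (intro finite_measure_finite_Union disj, auto)
  also have "\<dots> = (\<Sum>k\<in>?K. (v - u) / 2)"
  proof (rule sum.cong[OF refl])
    fix k assume "k \<in> ?K"
    hence "measure L (?I k) = (1 / 4 * u + 3 / 4 * v + s k) - (3 / 4 * u + 1 / 4 * v + s k)"
      using IX uv by (intro measure_L_Ioo) auto
    thus "measure L (?I k) = (v - u) / 2" by (simp add: field_simps)
  qed
  also have "\<dots> = real ((3 * h + 3) div 4 - (h + 3) div 4) * ((v - u) / 2)" by simp
  finally have eq: "measure L (core u v h s) = real ((3 * h + 3) div 4 - (h + 3) div 4) * ((v - u) / 2)" .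
  \<comment> \<open>Rounding costs at most \<open>3/4\<close> of a level compared with half of the \<open>h\<close> levels.\<close>
  have "2 * h \<le> 4 * ((3 * h + 3) div 4 - (h + 3) div 4) + 3" by linarith
  hence "2 * real h \<le> 4 * real ((3 * h + 3) div 4 - (h + 3) div 4) + 3" by linarith
  hence "(2 * real h - 3) * ((v - u) / 8) \<le> (4 * real ((3 * h + 3) div 4 - (h + 3) div 4)) * ((v - u) / 8)"
    using uv by (intro mult_right_mono) auto
  thus ?thesis unfolding eq by (simp add: field_simps)
qed

lemma core_almost_invariant:
  assumes t: "tower u v h s"
  shows "core u v h s - f -` core u v h s \<in> sets L"
    and "measure L (core u v h s - f -` core u v h s) \<le> v - u"
proof -
  let ?C = "core u v h s"
  let ?I = "\<lambda>k. {3 / 4 * u + 1 / 4 * v + s k<..<1 / 4 * u + 3 / 4 * v + s k}"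
  have uv: "u < v" using t by (simp add: tower_def)
  have C: "?C \<in> sets L" by (rule core_in_sets_L[OF t])
  have "?C - f -` ?C = ?C - (f -` ?C \<inter> space L)"
    using core_subset_X[OF t] by (auto simp: space_L)
  thus m: "?C - f -` ?C \<in> sets L" using C measurable_sets[OF f_measurable C] by auto
  have lev: "?I k = (f ^^ k) ` {3 / 4 * u + 1 / 4 * v<..<1 / 4 * u + 3 / 4 * v}" if "k < h" for k
    using uv by (intro tower_level_eq[OF t that, symmetric]) linarith+
  define m where "m = (3 * h + 3) div 4 - 1"
  \<comment> \<open>Only from the top level of the core can a point leave the core.\<close>
  have sub: "?C - f -` ?C \<subseteq> {u + s m<..<v + s m}" and mh: "m < h" if ne: "?C - f -` ?C \<noteq> {}"
  proof -
    have A: "x \<in> {u + s m<..<v + s m} \<and> m < h" if x: "x \<in> ?C - f -` ?C" for x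
    proof -
      from x obtain k where k: "h \<le> 4 * k" "4 * k < 3 * h" "x \<in> ?I k" by (auto simp: core_def)
      hence kh: "k < h" by simp
      then obtain y where y: "y \<in> {3 / 4 * u + 1 / 4 * v<..<1 / 4 * u + 3 / 4 * v}" "x = (f ^^ k) y"
        using lev k(3) by auto
      have "\<not> 4 * Suc k < 3 * h"
      proof
        assume k': "4 * Suc k < 3 * h"
        have "f x \<in> ?I (Suc k)" using lev[of "Suc k"] k' y by auto
        hence "f x \<in> ?C" using k(1) k' unfolding core_def by (intro UN_I[of "Suc k"]) auto
        thus False using x by simp
      qed
      hence "k = m" using k by (simp add: m_def)
      thus ?thesis using k(3) core_level_subset[OF uv, of "s k"] kh by blast
    qed
    show "?C - f -` ?C \<subseteq> {u + s m<..<v + s m}" using A by blast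
    show "m < h" using A ne by blast
  qed
  show "measure L (?C - f -` ?C) \<le> v - u"
  proof (cases "?C - f -` ?C = {}")
    case True
    show ?thesis unfolding True using uv by simp
  next
    case False
    have X: "{u + s m<..<v + s m} \<subseteq> X" by (rule tower_level_subset[OF t mh[OF False]])
    have "measure L (?C - f -` ?C) \<le> measure L {u + s m<..<v + s m}"
      using sub[OF False] Ioo_in_sets_L[OF X] by (rule finite_measure_mono)
    also have "\<dots> = v - u" using X uv by (subst measure_L_Ioo) auto
    finally show ?thesis .
  qed
qed

text \<open>
  The cores have measure bounded below, so their limit superior has positive measure. A point
  leaves the \<open>n\<close>-th core under \<open>f\<close> only from its top level, which is as short as the base; the lengths
  are summable, so by Borel-Cantelli the limit superior is forward invariant up to a null set.
\<close>

lemma limsup_core_conull: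
  fixes u v :: "nat \<Rightarrow> real" and h :: "nat \<Rightarrow> nat" and s :: "nat \<Rightarrow> nat \<Rightarrow> real"
  assumes t: "\<And>n. tower (u n) (v n) (h n) (s n)"
    and small: "\<And>n. v n - u n \<le> b * (1 / 2) ^ n"
    and large: "\<And>n. c0 \<le> real (h n) * (v n - u n)" and c0: "c0 > 0"
  shows "emeasure L (X - (\<Inter>N. \<Union>n\<in>{N..}. core (u n) (v n) (h n) (s n))) = 0"
proof -
  define C where "C n = core (u n) (v n) (h n) (s n)" for n
  define G where "G N = (\<Union>n\<in>{N..}. C n)" for N
  define Hs where "Hs = (\<Inter>N. G N)"
  have C[measurable]: "C n \<in> sets L" for n unfolding C_def by (rule core_in_sets_L[OF t])
  have G[measurable]: "G N \<in> sets L" for N unfolding G_def by auto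
  have Hs: "Hs \<in> sets L" unfolding Hs_def by auto
  have E: "C n - f -` C n \<in> sets L" "measure L (C n - f -` C n) \<le> b * (1 / 2) ^ n" for n
    using core_almost_invariant[OF t[of n]] small[of n] by (auto simp: C_def)
  have "AE x in L. \<forall>\<^sub>F n in sequentially. x \<in> space L - (C n - f -` C n)"
  proof (rule borel_cantelli_AE1[OF E(1)])
    show "summable (\<lambda>n. measure L (C n - f -` C n))"
      by (rule summable_comparison_test'[of "\<lambda>n. b * (1 / 2) ^ n"])
         (use E(2) in \<open>auto intro!: summable_mult summable_geometric\<close>)
  qed (simp add: emeasure_eq_measure)
  hence "AE x in L. x \<notin> Hs - f -` Hs"
  proof (rule AE_mp, intro AE_I2 impI)
    fix x assume ev: "\<forall>\<^sub>F n in sequentially. x \<in> space L - (C n - f -` C n)"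
    then obtain N0 where N0: "\<And>n. n \<ge> N0 \<Longrightarrow> x \<in> C n \<Longrightarrow> f x \<in> C n"
      by (auto simp: eventually_sequentially)
    have "f x \<in> Hs" if x: "x \<in> Hs"
    proof -
      have "f x \<in> G N" for N
      proof -
        have "x \<in> G (max N N0)" using x by (auto simp: Hs_def)
        then obtain n where "n \<ge> max N N0" "x \<in> C n" by (auto simp: G_def)
        thus ?thesis using N0[of n] by (auto simp: G_def)
      qed
      thus ?thesis by (simp add: Hs_def)
    qed
    thus "x \<notin> Hs - f -` Hs" by blast
  qed
  moreover have "Hs - f -` Hs \<in> sets L"
  proof -
    have "Hs - f -` Hs = Hs - (f -` Hs \<inter> space L)" using sets.sets_into_space[OF Hs] by auto
    thus ?thesis using Hs measurable_sets[OF f_measurable Hs] by auto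
  qed
  moreover have "Hs \<subseteq> space L" using Hs by (rule sets.sets_into_space)
  ultimately have "emeasure L (Hs - f -` Hs) = 0"
    by (subst (asm) AE_iff_measurable[of "Hs - f -` Hs"]) auto
  hence dich: "emeasure L Hs = 0 \<or> emeasure L (space L - Hs) = 0"
    by (rule ergodic_almost_forward_invariant_set[OF erg Hs])
  have "c0 / 8 \<le> measure L Hs"
  proof -
    have "(\<lambda>N. measure L (G N)) \<longlonglongrightarrow> measure L (\<Inter>N. G N)"
      by (rule finite_Lim_measure_decseq) (fastforce simp: decseq_def G_def)+
    hence lim: "(\<lambda>N. measure L (G N)) \<longlonglongrightarrow> measure L Hs" by (simp add: Hs_def)
    have "(\<lambda>n. b * (1 / 2) ^ n) \<longlonglongrightarrow> b * 0"
      by (intro tendsto_intros LIMSEQ_realpow_zero) auto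
    hence "\<forall>\<^sub>F n in sequentially. b * (1 / 2) ^ n < c0 / 3"
      using c0 by (intro order_tendstoD) auto
    hence "\<forall>\<^sub>F N in sequentially. c0 / 8 \<le> measure L (G N)"
    proof eventually_elim
      case (elim N)
      have "v N - u N < c0 / 3" using small[of N] elim by (rule order.strict_trans1)
      hence "3 * (v N - u N) \<le> c0" by simp
      hence "c0 / 8 \<le> (2 * real (h N) * (v N - u N) - 3 * (v N - u N)) / 8"
        using large[of N] by (simp add: field_simps)
      also have "\<dots> \<le> measure L (C N)" unfolding C_def by (rule measure_core_ge[OF t])
      also have "\<dots> \<le> measure L (G N)" by (rule finite_measure_mono) (auto simp: G_def)
      finally show ?case .
    qed
    thus ?thesis using tendsto_lowerbound[OF lim] sequentially_bot by blast
  qed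
  hence "emeasure L Hs \<noteq> 0" using c0 by (auto simp: measure_def)
  thus ?thesis using dich by (simp add: space_L Hs_def G_def C_def)
qed

end

section \<open>Weak mixing of the induced maps\<close>

lemma (in finite_measure) measure_sym_diff_triangle:
  assumes "P \<in> sets M" "Q \<in> sets M" "R \<in> sets M"
  shows "measure M (sym_diff P R) \<le> measure M (sym_diff P Q) + measure M (sym_diff Q R)"
proof -
  have "measure M (sym_diff P R) \<le> measure M (sym_diff P Q \<union> sym_diff Q R)"
    using assms by (intro finite_measure_mono) auto
  also have "\<dots> \<le> measure M (sym_diff P Q) + measure M (sym_diff Q R)"
    using assms by (intro measure_Un_le) auto
  finally show ?thesis .
qed

lemma measure_preserving_sym_diff:
  assumes mp: "measure_preserving M T" and "P \<in> sets M" "Q \<in> sets M"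
  shows "measure M (sym_diff (T -` P \<inter> space M) (T -` Q \<inter> space M)) = measure M (sym_diff P Q)"
proof -
  have "sym_diff (T -` P \<inter> space M) (T -` Q \<inter> space M) = T -` sym_diff P Q \<inter> space M" by auto
  moreover have "sym_diff P Q \<in> sets M" using assms(2,3) by auto
  ultimately show ?thesis using measure_preserving_measure[OF mp] by metis
qed

context ergodic_iet
begin

text \<open>
  Disjointness of the levels makes this a counting argument: at most \<open>card E\<close> of the levels in \<open>J\<close>
  meet \<open>E\<close>, and the others, about a quarter of the \<open>h\<close> levels, have total measure at least \<open>c0 / 8\<close>.
  If each of them had more than a sixteenth of its length in \<open>Bad\<close>, then \<open>Bad\<close> would be too large.
\<close>

lemma good_level:
  assumes t: "tower u v h s" and J: "J \<subseteq> {..<h}" "real h \<le> 4 * real (card J) + 4"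
    and c0: "c0 \<le> real h * (v - u)" and E: "finite E"
    and small: "(1 + real (card E)) * (v - u) \<le> c0 / 8"
    and Bad: "Bad \<in> sets L" "measure L Bad < c0 / 128"
  obtains j where "j \<in> J" "{u + s j<..<v + s j} \<inter> E = {}"
    "measure L (Bad \<inter> {u + s j<..<v + s j}) \<le> (v - u) / 16"
proof (rule ccontr)
  assume no: "\<not> thesis"
  let ?lev = "\<lambda>j. {u + s j<..<v + s j}"
  have uv: "u < v" using t by (simp add: tower_def)
  have finJ: "finite J" using J(1) finite_subset by blast
  have disj: "?lev j \<inter> ?lev k = {}" if "j \<in> J" "k \<in> J" "j \<noteq> k" for j k
    using t J(1) that unfolding tower_def by (metis lessThan_iff subsetD)
  define J1 where "J1 = {j \<in> J. ?lev j \<inter> E \<noteq> {}}"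
  define J2 where "J2 = {j \<in> J. ?lev j \<inter> E = {}}"
  have lev: "?lev j \<in> sets L" if "j \<in> J" for j
  proof (rule Ioo_in_sets_L)
    show "?lev j \<subseteq> X" using that J(1) by (intro tower_level_subset[OF t]) auto
  qed
  have "card J1 \<le> card E"
  proof -
    have "\<forall>j\<in>J1. \<exists>e. e \<in> ?lev j \<inter> E" unfolding J1_def by blast
    from bchoice[OF this] obtain e where "\<forall>j\<in>J1. e j \<in> ?lev j \<inter> E" ..
    hence e: "e j \<in> ?lev j \<inter> E" if "j \<in> J1" for j using that by (rule bspec)
    have "inj_on e J1"
    proof (rule inj_onI)
      fix j k assume jk: "j \<in> J1" "k \<in> J1" "e j = e k"
      have "e j \<in> ?lev j" using e[OF jk(1)] by (rule IntD1)
      moreover have "e j \<in> ?lev k" using e[OF jk(2)] unfolding jk(3) by (rule IntD1)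
      ultimately have "?lev j \<inter> ?lev k \<noteq> {}" by (metis IntI empty_iff)
      moreover have "j \<in> J" "k \<in> J" using jk by (simp_all add: J1_def)
      ultimately show "j = k" using disj by metis
    qed
    moreover have "e ` J1 \<subseteq> E" using e by blast
    ultimately show ?thesis using E by (rule card_inj_on_le)
  qed
  moreover have "card J = card J1 + card J2"
  proof -
    have "J = J1 \<union> J2" "J1 \<inter> J2 = {}" by (auto simp: J1_def J2_def)
    thus ?thesis using finJ by (metis card_Un_disjoint finite_Un)
  qed
  ultimately have cJ: "real (card J) \<le> real (card E) + real (card J2)" by linarith
  have "c0 / 8 \<le> real (card J2) * (v - u)"
  proof -
    have "real h * (v - u) \<le> (4 * (real (card E) + real (card J2)) + 4) * (v - u)"
      using J(2) cJ uv by (intro mult_right_mono) auto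
    hence "c0 \<le> 4 * (real (card J2) * (v - u)) + 4 * ((1 + real (card E)) * (v - u))"
      using c0 by (simp add: algebra_simps)
    thus ?thesis using small by linarith
  qed
  moreover have "real (card J2) * ((v - u) / 16) \<le> measure L Bad"
  proof -
    have gt: "(v - u) / 16 < measure L (Bad \<inter> ?lev j)" if "j \<in> J2" for j
      using no \<open>\<And>j. j \<in> J \<Longrightarrow> _ \<Longrightarrow> _ \<Longrightarrow> thesis\<close>[of j] that unfolding J2_def by force
    have "real (card J2) * ((v - u) / 16) = (\<Sum>j\<in>J2. (v - u) / 16)" by simp
    also have "\<dots> \<le> (\<Sum>j\<in>J2. measure L (Bad \<inter> ?lev j))"
      using gt by (intro sum_mono less_imp_le)
    also have "\<dots> = measure L (\<Union>j\<in>J2. Bad \<inter> ?lev j)"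
    proof (rule finite_measure_finite_Union[symmetric])
      show "finite J2" using finJ by (simp add: J2_def)
      show "(\<lambda>j. Bad \<inter> ?lev j) ` J2 \<subseteq> sets L"
        using lev Bad(1) by (intro image_subsetI sets.Int) (auto simp: J2_def)
      show "disjoint_family_on (\<lambda>j. Bad \<inter> ?lev j) J2"
        using disj unfolding disjoint_family_on_def J2_def by blast
    qed
    also have "\<dots> \<le> measure L Bad" using Bad(1) by (intro finite_measure_mono) auto
    finally show ?thesis .
  qed
  ultimately show False using Bad(2) by (simp add: field_simps)
qed

text \<open>
  Here \<open>T\<^sup>-\<^sup>1\<close> is applied once for every visit of the orbit below \<open>t\<close>.
\<close>

lemma cocycle_iterate:
  assumes T: "T \<in> space N \<rightarrow> space N"
    and sub: "\<And>x. \<Phi> x \<subseteq> space N"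
    and lo: "\<And>x. x \<in> X \<Longrightarrow> x < t \<Longrightarrow> \<Phi> x = T -` \<Phi> (f x) \<inter> space N"
    and hi: "\<And>x. x \<in> X \<Longrightarrow> t \<le> x \<Longrightarrow> \<Phi> x = \<Phi> (f x)"
    and x: "x \<in> X"
  shows "\<Phi> x = (T ^^ card {j. j < n \<and> (f ^^ j) x < t}) -` \<Phi> ((f ^^ n) x) \<inter> space N"
proof (induction n)
  case 0
  show ?case using sub[of x] by auto
next
  case (Suc n)
  let ?c = "card {j. j < n \<and> (f ^^ j) x < t}"
  have y: "(f ^^ n) x \<in> X" by (rule funpow_in_X[OF x])
  show ?case
  proof (cases "(f ^^ n) x < t")
    case True
    have "{j. j < Suc n \<and> (f ^^ j) x < t} = insert n {j. j < n \<and> (f ^^ j) x < t}"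
      using True by (auto simp: less_Suc_eq)
    hence c: "card {j. j < Suc n \<and> (f ^^ j) x < t} = Suc ?c" by simp
    have sp: "(T ^^ k) y \<in> space N" if "y \<in> space N" for k y
      using T that by (induction k) auto
    have "\<Phi> x = (T ^^ ?c) -` (T -` \<Phi> (f ((f ^^ n) x)) \<inter> space N) \<inter> space N"
      using Suc lo[OF y True] by simp
    also have "\<dots> = (T ^^ Suc ?c) -` \<Phi> ((f ^^ Suc n) x) \<inter> space N"
      using sp by auto
    finally show ?thesis unfolding c .
  next
    case False
    hence "{j. j < Suc n \<and> (f ^^ j) x < t} = {j. j < n \<and> (f ^^ j) x < t}"
      by (auto simp: less_Suc_eq)
    thus ?thesis using Suc hi[OF y] False by simp
  qed
qed

text \<open>
  Fix a good level \<open>j1\<close> at or below the level of \<open>t\<close> and a good level \<open>j2\<close> above it, and base points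
  \<open>x\<close>, \<open>y\<close> that pass the level of \<open>t\<close> on its left and on its right. From level \<open>j1\<close> to level \<open>j2\<close> the point \<open>x\<close> visits
  \<open>[0, t)\<close> once more than \<open>y\<close>, say \<open>m + 1\<close> and \<open>m\<close> times. Write \<open>P\<close> and \<open>Q\<close> for the values of \<open>\<Phi>\<close> on
  the two levels, which are the same at \<open>x\<close> and at \<open>y\<close> up to \<open>2\<eta>\<close>. Then \<open>P\<close> is close to both
  \<open>T\<^sup>-\<^sup>m\<^sup>-\<^sup>1 Q\<close> and \<open>T\<^sup>-\<^sup>m Q\<close>, so \<open>T\<^sup>-\<^sup>1 Q\<close> is close to \<open>Q\<close>. This applies to all \<open>y\<close> on the right
  outside a set of smaller measure.
\<close>

lemma tower_forces_small_defect:
  fixes N :: "'a measure" and \<Phi> \<psi> :: "real \<Rightarrow> 'a set"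
  assumes N: "prob_space N" and mpT: "measure_preserving N T"
    and \<Phi>: "\<And>x. \<Phi> x \<in> sets N" and \<psi>: "\<And>x. \<psi> x \<in> sets N"
    and lo: "\<And>x. x \<in> X \<Longrightarrow> x < t \<Longrightarrow> \<Phi> x = T -` \<Phi> (f x) \<inter> space N"
    and hi: "\<And>x. x \<in> X \<Longrightarrow> t \<le> x \<Longrightarrow> \<Phi> x = \<Phi> (f x)"
    and tow: "tower u v h s" and t: "t \<in> core u v h s" and c0: "c0 \<le> real h * (v - u)"
    and E: "finite E" and small: "(1 + real (card E)) * (v - u) \<le> c0 / 8"
    and const: "\<And>x x'. x \<in> X \<Longrightarrow> x' \<in> X \<Longrightarrow> x < x' \<Longrightarrow> {x..x'} \<inter> E = {} \<Longrightarrow> \<psi> x = \<psi> x'"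
    and Bad_def: "Bad = {x \<in> X. \<eta> \<le> measure N (sym_diff (\<Phi> x) (\<psi> x))}"
    and Bad: "Bad \<in> sets L" "measure L Bad < c0 / 128"
    and K: "{x \<in> X. measure N (sym_diff (T -` \<Phi> x \<inter> space N) (\<Phi> x)) \<le> 4 * \<eta>} \<in> sets L"
  shows "emeasure L {x \<in> X. measure N (sym_diff (T -` \<Phi> x \<inter> space N) (\<Phi> x)) \<le> 4 * \<eta>} \<noteq> 0"
proof -
  interpret N: prob_space N by fact
  have T: "T \<in> measurable N N" using mpT by (rule measure_preserving_measurable)
  have Tsp: "T \<in> space N \<rightarrow> space N" using measurable_space[OF T] by auto
  let ?lev = "\<lambda>j. {u + s j<..<v + s j}"
  let ?d = "\<lambda>P Q. measure N (sym_diff P Q)"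
  have uv: "u < v" and base: "{u<..<v} \<subseteq> X"
    and tr: "\<And>k x. k < h \<Longrightarrow> x \<in> {u<..<v} \<Longrightarrow> (f ^^ k) x = x + s k"
    and disj: "\<And>j k. j < h \<Longrightarrow> k < h \<Longrightarrow> j \<noteq> k \<Longrightarrow> ?lev j \<inter> ?lev k = {}"
    using tow unfolding tower_def by blast+
  obtain k0 where k0: "h \<le> 4 * k0" "4 * k0 < 3 * h"
    and t0: "t \<in> {3 / 4 * u + 1 / 4 * v + s k0<..<1 / 4 * u + 3 / 4 * v + s k0}"
    using t unfolding core_def by blast
  have k0h: "k0 < h" using k0 by simp
  define w where "w = t - s k0"
  have w: "3 / 4 * u + 1 / 4 * v < w" "w < 1 / 4 * u + 3 / 4 * v" using t0 by (auto simp: w_def)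
  have uwv: "u < w" "w < v" using w uv by linarith+
  \<comment> \<open>One good level at or below the level of \<open>t\<close>, and one above it.\<close>
  have "{..k0} \<subseteq> {..<h}" "real h \<le> 4 * real (card {..k0}) + 4" using k0 by auto
  then obtain j1 where "j1 \<in> {..k0}" and E1: "?lev j1 \<inter> E = {}"
    and B1: "measure L (Bad \<inter> ?lev j1) \<le> (v - u) / 16"
    using good_level[OF tow _ _ c0 E small Bad] by blast
  hence j1: "j1 \<le> k0" by simp
  have "{k0<..<h} \<subseteq> {..<h}" "real h \<le> 4 * real (card {k0<..<h}) + 4" using k0 by auto
  then obtain j2 where "j2 \<in> {k0<..<h}" and E2: "?lev j2 \<inter> E = {}"
    and B2: "measure L (Bad \<inter> ?lev j2) \<le> (v - u) / 16"
    using good_level[OF tow _ _ c0 E small Bad] by blast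
  hence j2: "k0 < j2" "j2 < h" by auto
  have j1h: "j1 < h" using j1 k0h by simp
  have levX: "?lev j \<in> sets L" if "j < h" for j
    by (rule Ioo_in_sets_L[OF tower_level_subset[OF tow that]])
  define Z where "Z = (\<Union>j\<in>{j1, j2}. (f ^^ j) -` (Bad \<inter> ?lev j) \<inter> space L)"
  have pull: "(f ^^ j) -` (Bad \<inter> ?lev j) \<inter> space L \<in> sets L"
      "measure L ((f ^^ j) -` (Bad \<inter> ?lev j) \<inter> space L) = measure L (Bad \<inter> ?lev j)" if "j < h" for j
  proof -
    have S: "Bad \<inter> ?lev j \<in> sets L" using Bad(1) levX[OF that] by blast
    show "(f ^^ j) -` (Bad \<inter> ?lev j) \<inter> space L \<in> sets L"
      by (rule measurable_sets[OF measurable_funpow[OF f_measurable] S])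
    show "measure L ((f ^^ j) -` (Bad \<inter> ?lev j) \<inter> space L) = measure L (Bad \<inter> ?lev j)"
      by (rule measure_preserving_measure[OF measure_preserving_funpow[OF mp] S])
  qed
  have Z: "Z \<in> sets L" unfolding Z_def using pull(1) j1h j2 by auto
  have Z_le: "measure L Z \<le> (v - u) / 8"
  proof -
    have "measure L Z \<le> measure L (Bad \<inter> ?lev j1) + measure L (Bad \<inter> ?lev j2)"
      unfolding Z_def using measure_Un_le[OF pull(1)[OF j1h] pull(1)[OF j2(2)]] pull(2)[OF j1h] pull(2)[OF j2(2)]
      by simp
    thus ?thesis using B1 B2 by simp
  qed
  have good: "?d (\<Phi> ((f ^^ j) x)) (\<psi> ((f ^^ j) x)) < \<eta>"
    if x: "x \<in> {u<..<v} - Z" and j: "j \<in> {j1, j2}" for x j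
  proof -
    have jh: "j < h" using j j1h j2 by auto
    have xX: "x \<in> X" using x base by blast
    have "(f ^^ j) x \<in> ?lev j" using tr[OF jh, of x] x by auto
    moreover have "x \<notin> (f ^^ j) -` (Bad \<inter> ?lev j) \<inter> space L" using x j unfolding Z_def by blast
    ultimately have "(f ^^ j) x \<notin> Bad" using xX by (auto simp: space_L)
    moreover have "(f ^^ j) x \<in> X" by (rule funpow_in_X[OF xX])
    ultimately show ?thesis unfolding Bad_def by auto
  qed
  have \<psi>_eq: "\<psi> ((f ^^ j) x) = \<psi> ((f ^^ j) x')"
    if "x \<in> {u<..<v}" "x' \<in> {u<..<v}" "x < x'" and j: "j \<in> {j1, j2}" for x x' j
  proof -
    have jh: "j < h" using j j1h j2 by auto
    have "{x + s j..x' + s j} \<subseteq> ?lev j" using that by auto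
    hence "{x + s j..x' + s j} \<inter> E = {}" using E1 E2 j by blast
    moreover have "x + s j \<in> ?lev j" "x' + s j \<in> ?lev j" using that by auto
    hence "x + s j \<in> X" "x' + s j \<in> X" using tower_level_subset[OF tow jh] by blast+
    ultimately show ?thesis using tr[OF jh] that const[of "x + s j" "x' + s j"] by simp
  qed
  have interval: "(v - u) / 8 < measure L {p<..<q}" if "u \<le> p" "q \<le> v" "v - u < 4 * q - 4 * p" for p q
  proof -
    have "{p<..<q} \<subseteq> X" using that base by force
    moreover have "p \<le> q" using that uv by linarith
    ultimately have "measure L {p<..<q} = q - p" by (intro measure_L_Ioo)
    thus ?thesis using that uv by (simp add: field_simps)
  qed
  have left: "(v - u) / 8 < measure L {u<..<w}" by (rule interval) (use w uwv in linarith)+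
  have right: "(v - u) / 8 < measure L {w<..<v}" by (rule interval) (use w uwv in linarith)+
  have IL: "{u<..<w} \<in> sets L" "{w<..<v} \<in> sets L"
    using base uwv by (auto intro!: Ioo_in_sets_L simp: subset_iff)
  obtain x where x: "x \<in> {u<..<w}" "x \<notin> Z"
  proof -
    have "\<not> {u<..<w} \<subseteq> Z"
    proof
      assume "{u<..<w} \<subseteq> Z"
      hence "measure L {u<..<w} \<le> measure L Z" using Z by (rule finite_measure_mono)
      thus False using left Z_le by linarith
    qed
    thus ?thesis using that by blast
  qed
  have xb: "x \<in> {u<..<v} - Z" using x uwv by auto
  \<comment> \<open>Between the two good levels the orbit of \<open>x\<close> makes exactly one more visit below \<open>t\<close> than
    the orbit of a point of the right part.\<close>
  have small_right: "?d (T -` \<Phi> ((f ^^ j2) y) \<inter> space N) (\<Phi> ((f ^^ j2) y)) \<le> 4 * \<eta>"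
    if y: "y \<in> {w<..<v} - Z" for y
  proof -
    have yb: "y \<in> {u<..<v} - Z" and xy: "x < y" using y x uwv by auto
    define n where "n = j2 - j1"
    define cnt where "cnt z = card {j. j < n \<and> (f ^^ j) ((f ^^ j1) z) < t}" for z
    define m where "m = cnt y"
    define P where "P z = \<Phi> ((f ^^ j1) z)" for z
    define Q where "Q z = \<Phi> ((f ^^ j2) z)" for z
    define pre where "pre c R = (T ^^ c) -` R \<inter> space N" for c R
    have iter: "P z = pre (cnt z) (Q z)" if "z \<in> X" for z
    proof -
      have "(f ^^ n) ((f ^^ j1) z) = (f ^^ j2) z" using j1 j2 by (simp add: n_def funpow_funpow)
      thus ?thesis
        using cocycle_iterate[where \<Phi>=\<Phi> and T=T and N=N and t=t and x="(f ^^ j1) z" and n=n,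
            OF Tsp sets.sets_into_space[OF \<Phi>] lo hi funpow_in_X[OF that]]
        by (simp add: P_def Q_def pre_def cnt_def)
    qed
    have cnt: "cnt x = Suc m"
    proof -
      have pos: "(f ^^ j) ((f ^^ j1) z) = z + s (j1 + j)" if "z \<in> {u<..<v}" "j < n" for z j
        using tr[of "j1 + j" z] that j2 by (simp add: funpow_funpow add.commute n_def)
      have at: "x + s k0 < t" "\<not> y + s k0 < t" using x y by (auto simp: w_def)
      have off: "x + s k < t \<longleftrightarrow> y + s k < t" if "k < h" "k \<noteq> k0" for k
      proof -
        have "t \<in> ?lev k0" using t0 core_level_subset[OF uv, of "s k0"] by blast
        hence "t \<notin> ?lev k" using disj[OF that(1) k0h that(2)] by blast
        thus ?thesis using xb yb by auto
      qed
      have "{j. j < n \<and> (f ^^ j) ((f ^^ j1) x) < t} =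
          insert (k0 - j1) {j. j < n \<and> (f ^^ j) ((f ^^ j1) y) < t}" (is "?Sx = insert _ ?Sy")
      proof (intro set_eqI iffI)
        fix j assume j: "j \<in> ?Sx"
        show "j \<in> insert (k0 - j1) ?Sy"
        proof (cases "j1 + j = k0")
          case False
          have "j1 + j < h" using j j2 by (auto simp: n_def)
          thus ?thesis using j off[OF _ False] pos xb yb by auto
        qed auto
      next
        fix j assume j: "j \<in> insert (k0 - j1) ?Sy"
        show "j \<in> ?Sx"
        proof (cases "j1 + j = k0")
          case True
          have "j < n" using True j1 j2 by (auto simp: n_def)
          thus ?thesis using True at pos[of x j] xb by auto
        next
          case False
          hence jy: "j \<in> ?Sy" using j j1 by auto
          have "j1 + j < h" using jy j2 by (auto simp: n_def)
          thus ?thesis using jy off[OF _ False] pos xb yb by auto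
        qed
      qed
      moreover have "k0 - j1 \<notin> ?Sy"
      proof
        assume "k0 - j1 \<in> ?Sy"
        thus False using pos[of y "k0 - j1"] yb at j1 by auto
      qed
      ultimately show ?thesis unfolding cnt_def m_def by simp
    qed
    have meas: "P z \<in> sets N" "Q z \<in> sets N" for z unfolding P_def Q_def by (rule \<Phi>)+
    have pre_sets: "pre c R \<in> sets N" if "R \<in> sets N" for c R
      unfolding pre_def by (rule measurable_sets[OF measurable_funpow[OF T] that])
    have pre_d: "?d (pre c R) (pre c R') = ?d R R'" if "R \<in> sets N" "R' \<in> sets N" for c R R'
      unfolding pre_def by (rule measure_preserving_sym_diff[OF measure_preserving_funpow[OF mpT] that])
    have pre_Suc: "pre (Suc c) R = pre c (pre 1 R)" for c R
    proof -
      have "(T ^^ c) y \<in> space N" if "y \<in> space N" for y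
        using measurable_space[OF measurable_funpow[OF T] that] .
      thus ?thesis by (auto simp: pre_def)
    qed
    have near: "?d (\<Phi> ((f ^^ j) x)) (\<Phi> ((f ^^ j) y)) \<le> 2 * \<eta>" if j: "j \<in> {j1, j2}" for j
    proof -
      have "?d (\<Phi> ((f ^^ j) x)) (\<Phi> ((f ^^ j) y))
          \<le> ?d (\<Phi> ((f ^^ j) x)) (\<psi> ((f ^^ j) x)) + ?d (\<psi> ((f ^^ j) x)) (\<Phi> ((f ^^ j) y))"
        by (rule N.measure_sym_diff_triangle[OF \<Phi> \<psi> \<Phi>])
      also have "?d (\<psi> ((f ^^ j) x)) (\<Phi> ((f ^^ j) y)) = ?d (\<Phi> ((f ^^ j) y)) (\<psi> ((f ^^ j) y))"
        using \<psi>_eq[of x y j] xb yb xy j by (simp add: Un_commute)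
      finally show ?thesis using good[OF xb j] good[OF yb j] by linarith
    qed
    have dP: "?d (P x) (P y) \<le> 2 * \<eta>" and dQ: "?d (Q x) (Q y) \<le> 2 * \<eta>"
      unfolding P_def Q_def by (rule near, simp)+
    have Px: "P x = pre (Suc m) (Q x)" using iter[of x] xb base cnt by auto
    have Py: "P y = pre m (Q y)" using iter[of y] yb base by (auto simp: m_def)
    have "?d (pre 1 (Q y)) (Q y) = ?d (pre (Suc m) (Q y)) (pre m (Q y))"
      unfolding pre_Suc by (rule pre_d[symmetric]) (intro pre_sets meas)+
    also have "\<dots> \<le> ?d (pre (Suc m) (Q y)) (P x) + ?d (P x) (pre m (Q y))"
      by (intro N.measure_sym_diff_triangle pre_sets meas)
    also have "?d (pre (Suc m) (Q y)) (P x) = ?d (Q x) (Q y)"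
      unfolding Px by (subst pre_d) (auto simp: meas Un_commute)
    also have "?d (P x) (pre m (Q y)) = ?d (P x) (P y)" unfolding Py ..
    finally have "?d (pre 1 (Q y)) (Q y) \<le> 4 * \<eta>" using dP dQ by linarith
    thus ?thesis by (simp add: pre_def Q_def)
  qed
  let ?K = "{x \<in> X. ?d (T -` \<Phi> x \<inter> space N) (\<Phi> x) \<le> 4 * \<eta>}"
  have "{w<..<v} - Z \<subseteq> (f ^^ j2) -` ?K \<inter> space L"
    using small_right base uwv funpow_in_X by (auto simp: space_L subset_iff)
  hence "measure L ({w<..<v} - Z) \<le> measure L ((f ^^ j2) -` ?K \<inter> space L)"
    by (rule finite_measure_mono) (rule measurable_sets[OF measurable_funpow[OF f_measurable] K])
  also have "\<dots> = measure L ?K"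
    by (rule measure_preserving_measure[OF measure_preserving_funpow[OF mp] K])
  finally have "measure L ({w<..<v} - Z) \<le> measure L ?K" .
  moreover have "measure L {w<..<v} \<le> measure L ({w<..<v} - Z) + measure L Z"
  proof -
    have "measure L {w<..<v} \<le> measure L (({w<..<v} - Z) \<union> Z)"
      using IL Z by (intro finite_measure_mono) auto
    also have "\<dots> \<le> measure L ({w<..<v} - Z) + measure L Z"
      using IL Z by (intro measure_Un_le) auto
    finally show ?thesis .
  qed
  ultimately have "0 < measure L ?K" using right Z_le by linarith
  thus ?thesis by (auto simp: measure_def)
qed

text \<open>
  The defect is \<open>f\<close>-invariant because \<open>T\<close> preserves the measure of symmetric differences. By
  ergodicity it is almost everywhere at most \<open>4\<eta>\<close> as soon as this holds on a set of positive
  measure, which a sufficiently thin tower around \<open>t\<close> provides for every \<open>\<eta> > 0\<close>.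
\<close>

lemma defect_null:
  fixes N :: "'a measure" and u v :: "nat \<Rightarrow> real"
  assumes N: "prob_space N" and mpT: "measure_preserving N T"
    and A: "A \<in> sets (L \<Otimes>\<^sub>M N)"
    and lo: "\<And>x. x \<in> X \<Longrightarrow> x < t \<Longrightarrow> Pair x -` A = T -` (Pair (f x) -` A) \<inter> space N"
    and hi: "\<And>x. x \<in> X \<Longrightarrow> t \<le> x \<Longrightarrow> Pair x -` A = Pair (f x) -` A"
    and tow: "\<And>n. tower (u n) (v n) (h n) (s n)"
    and small: "\<And>n. v n - u n \<le> b * (1 / 2) ^ n"
    and large: "\<And>n. c0 \<le> real (h n) * (v n - u n)" and c0: "c0 > 0"
    and t: "t \<in> (\<Inter>N. \<Union>n\<in>{N..}. core (u n) (v n) (h n) (s n))"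
  shows "AE x in L. measure N (sym_diff (T -` (Pair x -` A) \<inter> space N) (Pair x -` A)) = 0"
proof -
  interpret N: prob_space N by fact
  have T: "T \<in> measurable N N" using mpT by (rule measure_preserving_measurable)
  define \<Phi> where "\<Phi> x = Pair x -` A" for x
  define d where "d x = measure N (sym_diff (T -` \<Phi> x \<inter> space N) (\<Phi> x))" for x
  have \<Phi>: "\<Phi> x \<in> sets N" for x unfolding \<Phi>_def using A by (rule sets_Pair1)
  have T\<Phi>: "T -` \<Phi> x \<inter> space N \<in> sets N" for x by (rule measurable_sets[OF T \<Phi>])
  define B where "B = map_prod id T -` A \<inter> space (L \<Otimes>\<^sub>M N)"
  have "map_prod id T \<in> measurable (L \<Otimes>\<^sub>M N) (L \<Otimes>\<^sub>M N)"
    by (intro measurable_map_prod T measurable_ident)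
  hence B: "B \<in> sets (L \<Otimes>\<^sub>M N)" unfolding B_def using A by (rule measurable_sets)
  have sec: "Pair x -` sym_diff B A = sym_diff (T -` \<Phi> x \<inter> space N) (\<Phi> x)" if "x \<in> X" for x
    using that sets.sets_into_space[OF \<Phi>[of x]]
    by (auto simp: B_def \<Phi>_def space_pair_measure space_L)
  have meas: "(\<lambda>x. emeasure N (Pair x -` sym_diff B A)) \<in> borel_measurable L"
    using A B by (intro N.measurable_emeasure_Pair) auto
  have K: "{x \<in> X. d x \<le> r} \<in> sets L" for r
  proof -
    have eq: "{x \<in> X. d x \<le> r} = {x \<in> space L. enn2real (emeasure N (Pair x -` sym_diff B A)) \<le> r}"
      using sec by (auto simp: space_L d_def measure_def)
    show ?thesis unfolding eq using meas by measurable
  qed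
  have inv: "d (f x) = d x" if x: "x \<in> X" for x
  proof (cases "x < t")
    case True
    have eq: "\<Phi> x = T -` \<Phi> (f x) \<inter> space N" unfolding \<Phi>_def by (rule lo[OF x True])
    show ?thesis
      unfolding d_def eq by (rule measure_preserving_sym_diff[OF mpT T\<Phi> \<Phi>, symmetric])
  next
    case False
    hence "\<Phi> x = \<Phi> (f x)" unfolding \<Phi>_def using hi[OF x] by simp
    thus ?thesis by (simp add: d_def)
  qed
  have small_defect: "AE x in L. d x \<le> 4 * \<eta>" if \<eta>: "\<eta> > 0" for \<eta>
  proof -
    obtain \<psi> where pc: "piecewise_const X \<psi>" and \<psi>: "\<And>x. \<psi> x \<in> sets N"
      and Bad: "{x \<in> X. \<eta> \<le> measure N (sym_diff (Pair x -` A) (\<psi> x))} \<in> sets L"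
        "measure L {x \<in> X. \<eta> \<le> measure N (sym_diff (Pair x -` A) (\<psi> x))} < c0 / 128"
      using sections_approx_piecewise_const[OF N A \<eta>, of "c0 / 128"] c0 by auto
    obtain E where E: "finite E"
      and const: "\<And>x x'. x \<in> X \<Longrightarrow> x' \<in> X \<Longrightarrow> x < x' \<Longrightarrow> {x..x'} \<inter> E = {} \<Longrightarrow> \<psi> x = \<psi> x'"
      using pc unfolding piecewise_const_def by metis
    have "(\<lambda>n. (1 + real (card E)) * (b * (1 / 2) ^ n)) \<longlonglongrightarrow> (1 + real (card E)) * (b * 0)"
      by (intro tendsto_intros LIMSEQ_realpow_zero) auto
    from order_tendstoD(2)[OF this, of "c0 / 8"]
    have "\<forall>\<^sub>F n in sequentially. (1 + real (card E)) * (b * (1 / 2) ^ n) < c0 / 8"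
      using c0 by simp
    then obtain M where M: "\<And>n. n \<ge> M \<Longrightarrow> (1 + real (card E)) * (b * (1 / 2) ^ n) < c0 / 8"
      by (auto simp: eventually_sequentially)
    obtain n where n: "n \<ge> M" "t \<in> core (u n) (v n) (h n) (s n)" using t by blast
    have "(1 + real (card E)) * (v n - u n) \<le> (1 + real (card E)) * (b * (1 / 2) ^ n)"
      using small[of n] by (intro mult_left_mono) auto
    also have "\<dots> \<le> c0 / 8" using M[OF n(1)] by (rule less_imp_le)
    finally have sm: "(1 + real (card E)) * (v n - u n) \<le> c0 / 8" .
    have "emeasure L {x \<in> X. d x \<le> 4 * \<eta>} \<noteq> 0"
      unfolding d_def
    proof (rule tower_forces_small_defect[where \<Phi>=\<Phi> and \<psi>=\<psi> and E=E and t=t,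
          OF N mpT \<Phi> \<psi> _ _ tow n(2) large E sm const refl])
      show "\<Phi> x = T -` \<Phi> (f x) \<inter> space N" if "x \<in> X" "x < t" for x
        unfolding \<Phi>_def by (rule lo[OF that])
      show "\<Phi> x = \<Phi> (f x)" if "x \<in> X" "t \<le> x" for x
        unfolding \<Phi>_def by (rule hi[OF that])
      show "{x \<in> X. measure N (sym_diff (T -` \<Phi> x \<inter> space N) (\<Phi> x)) \<le> 4 * \<eta>} \<in> sets L"
        using K[of "4 * \<eta>"] by (simp only: d_def)
    qed (use Bad in \<open>simp_all only: \<Phi>_def\<close>)
    moreover have "emeasure L {x \<in> X. d x \<le> 4 * \<eta>} = 0 \<or> emeasure L (space L - {x \<in> X. d x \<le> 4 * \<eta>}) = 0"
      by (rule ergodic_invariant_set[OF erg K]) (use inv f_in_X in \<open>auto simp: space_L\<close>)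
    ultimately have "emeasure L (space L - {x \<in> X. d x \<le> 4 * \<eta>}) = 0" by blast
    hence "AE x in L. x \<notin> space L - {x \<in> X. d x \<le> 4 * \<eta>}"
      using K[of "4 * \<eta>"] by (intro AE_not_in) (auto simp: null_sets_def)
    thus ?thesis by (rule AE_mp) (auto intro!: AE_I2)
  qed
  have "AE x in L. \<forall>i::nat. d x \<le> 4 * (1 / real (Suc i))"
    unfolding AE_all_countable by (intro allI small_defect) simp
  thus ?thesis
  proof (rule AE_mp, intro AE_I2 impI)
    fix x assume le: "\<forall>i::nat. d x \<le> 4 * (1 / real (Suc i))"
    have "d x \<le> 0"
    proof (rule ccontr)
      assume "\<not> d x \<le> 0"
      then obtain i :: nat where "1 / real (Suc i) < d x / 4"
        by (metis nat_approx_posE not_le zero_less_divide_iff zero_less_numeral)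
      thus False using le[rule_format, of i] by simp
    qed
    hence "d x = 0" unfolding d_def using measure_le_0_iff by blast
    thus "measure N (sym_diff (T -` (Pair x -` A) \<inter> space N) (Pair x -` A)) = 0"
      by (simp add: d_def \<Phi>_def)
  qed
qed

text \<open>
  For a \<open>T \<times> T\<close>-invariant set \<open>A\<close>, \<open>defect_null\<close> applied to the extension of \<open>A\<close> along the entry map
  shows that almost every section of \<open>A\<close> is \<open>T\<close>-invariant modulo null sets, so it is null or
  conull; which of the two does not depend on the section, as \<open>T\<close> is ergodic.
\<close>

lemma weakly_mixing_first_return_map:
  fixes u v :: "nat \<Rightarrow> real"
  assumes t0: "0 < t" "t < b"
    and tow: "\<And>n. tower (u n) (v n) (h n) (s n)"
    and small: "\<And>n. v n - u n \<le> b * (1 / 2) ^ n"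
    and large: "\<And>n. c0 \<le> real (h n) * (v n - u n)" and c0: "c0 > 0"
    and t: "t \<in> (\<Inter>N. \<Union>n\<in>{N..}. core (u n) (v n) (h n) (s n))"
  shows "weakly_mixing (normalized_lebesgue_on {0..<t}) (first_return_map f {0..<t})"
proof -
  define Y where "Y = {0..<t}"
  define N where "N = normalized_lebesgue_on Y"
  define T where "T = first_return_map f Y"
  have YX: "Y \<subseteq> X" using t0 by (auto simp: Y_def)
  have Y: "Y \<in> sets L" using YX by (simp add: sets_L_iff Y_def)
  have ret: "Y \<subseteq> returns f Y" unfolding Y_def by (rule initial_interval_returns) (use t0 in simp)
  have R: "restrict_space L Y = lebesgue_on Y"
  proof -
    have "restrict_space L Y = restrict_space lebesgue (X \<inter> Y)"
      by (rule restrict_restrict_space) (simp_all add: Y_def)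
    thus ?thesis unfolding Int_absorb1[OF YX] .
  qed
  have NR: "N = scale_measure (inverse (emeasure lebesgue Y)) (restrict_space L Y)"
    by (simp add: N_def normalized_lebesgue_on_def R)
  have sets_N: "sets N = sets (restrict_space L Y)" by (simp add: NR)
  have space_N: "space N = Y" using YX by (simp add: NR space_scale_measure space_restrict_space Int_absorb2)
  have emY: "emeasure lebesgue Y = ennreal t" using t0 by (simp add: Y_def)
  have "emeasure N (space N) = 1"
  proof -
    have "emeasure (restrict_space L Y) Y = ennreal t"
      unfolding R by (subst emeasure_restrict_space) (auto simp: emY, simp add: Y_def)
    thus ?thesis using t0 unfolding space_N by (simp add: NR emY inverse_ennreal flip: ennreal_mult)
  qed
  hence "prob_space N" by (rule prob_spaceI)
  then interpret N: prob_space N .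
  interpret NN: pair_prob_space N N ..
  have ergT: "ergodic N T"
    unfolding NR T_def
    by (intro ergodic_scale_measure ergodic_first_return_map erg Y ret finite_measure_axioms)
  have mpT: "measure_preserving N T" using ergT by (rule ergodic_measure_preserving)
  have T: "T \<in> measurable N N" using mpT by (rule measure_preserving_measurable)
  have Tsp: "T x \<in> Y" if "x \<in> Y" for x using measurable_space[OF T, of x] that by (simp add: space_N)
  let ?TT = "map_prod T T"
  have "emeasure (N \<Otimes>\<^sub>M N) A = 0 \<or> emeasure (N \<Otimes>\<^sub>M N) (space (N \<Otimes>\<^sub>M N) - A) = 0"
    if A: "A \<in> sets (N \<Otimes>\<^sub>M N)" and invA: "?TT -` A \<inter> space (N \<Otimes>\<^sub>M N) = A" for A
  proof -
    have AY: "A \<subseteq> Y \<times> Y" using sets.sets_into_space[OF A] by (simp add: space_pair_measure space_N)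
    have inv: "(T x, T y) \<in> A \<longleftrightarrow> (x, y) \<in> A" if "x \<in> Y" "y \<in> Y" for x y
    proof -
      have "(x, y) \<in> ?TT -` A \<inter> space (N \<Otimes>\<^sub>M N) \<longleftrightarrow> (T x, T y) \<in> A"
        using that by (simp add: space_pair_measure space_N)
      thus ?thesis unfolding invA by simp
    qed
    define e where "e = entry_map f Y 0"
    have "0 \<in> Y" using t0 by (simp add: Y_def)
    hence "e \<in> measurable L (restrict_space L Y)"
      unfolding e_def by (intro measurable_entry_map f_measurable Y)
    hence e: "e \<in> measurable L N" using sets_N measurable_cong_sets by blast
    have eY: "e x \<in> Y" for x unfolding e_def using \<open>0 \<in> Y\<close> by (rule entry_map_mem)
    define A1 where "A1 = map_prod e id -` A \<inter> space (L \<Otimes>\<^sub>M N)"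
    have "map_prod e id \<in> measurable (L \<Otimes>\<^sub>M N) (N \<Otimes>\<^sub>M N)"
      by (intro measurable_map_prod e measurable_ident)
    hence A1: "A1 \<in> sets (L \<Otimes>\<^sub>M N)" unfolding A1_def using A by (rule measurable_sets)
    have sec: "Pair x -` A1 = {y \<in> Y. (e x, y) \<in> A}" if "x \<in> X" for x
      using that by (auto simp: A1_def space_pair_measure space_N space_L)
    have "AE x in L. measure N (sym_diff (T -` (Pair x -` A1) \<inter> space N) (Pair x -` A1)) = 0"
    proof (rule defect_null[OF \<open>prob_space N\<close> mpT A1 _ _ tow small large c0 t])
      fix x assume x: "x \<in> X" "x < t"
      hence xY: "x \<in> Y" by (simp add: Y_def)
      have "e x = x" unfolding e_def by (rule entry_map_in[OF xY])
      moreover have "e (f x) = T x"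
        unfolding e_def T_def using ret xY by (intro first_return_map_eq_entry_map[symmetric]) auto
      ultimately show "Pair x -` A1 = T -` (Pair (f x) -` A1) \<inter> space N"
        using inv xY Tsp unfolding sec[OF x(1)] sec[OF f_in_X[OF x(1)]] space_N by auto
    next
      fix x assume x: "x \<in> X" "t \<le> x"
      hence "x \<notin> Y" by (simp add: Y_def)
      hence "e (f x) = e x" unfolding e_def by (rule entry_map_step)
      thus "Pair x -` A1 = Pair (f x) -` A1" unfolding sec[OF x(1)] sec[OF f_in_X[OF x(1)]] by simp
    qed
    hence "AE x in L. x \<in> Y \<longrightarrow> measure N (sym_diff (T -` (Pair x -` A1) \<inter> space N) (Pair x -` A1)) = 0"
      by (rule AE_mp) (auto intro!: AE_I2)
    hence "AE x in restrict_space L Y. measure N (sym_diff (T -` (Pair x -` A1) \<inter> space N) (Pair x -` A1)) = 0"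
      using Y by (subst AE_restrict_space_iff) auto
    hence AE0: "AE x in N. measure N (sym_diff (T -` (Pair x -` A1) \<inter> space N) (Pair x -` A1)) = 0"
      unfolding NR by (rule AE_scale_measure)
    have secA: "Pair x -` A \<in> sets N" for x using A by (rule sets_Pair1)
    have dich: "AE x in N. measure N (Pair x -` A) = 0 \<or> measure N (space N - Pair x -` A) = 0"
      using AE0
    proof (rule AE_mp, intro AE_I2 impI)
      fix x assume x: "x \<in> space N"
        and z: "measure N (sym_diff (T -` (Pair x -` A1) \<inter> space N) (Pair x -` A1)) = 0"
      let ?S = "Pair x -` A"
      have xY: "x \<in> Y" using x space_N by simp
      have "e x = x" unfolding e_def by (rule entry_map_in[OF xY])
      moreover have "x \<in> X" using xY YX by blast
      ultimately have "Pair x -` A1 = {y \<in> Y. (x, y) \<in> A}" using sec[of x] by simp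
      also have "\<dots> = ?S" using AY by auto
      finally have eq: "Pair x -` A1 = ?S" .
      have TS: "T -` ?S \<inter> space N \<in> sets N" by (rule measurable_sets[OF T secA])
      have "emeasure N (sym_diff (T -` ?S \<inter> space N) ?S) = 0"
        using z unfolding eq by (simp add: N.emeasure_eq_measure)
      hence "emeasure N (?S - T -` ?S) = 0"
        by (rule emeasure_eq_0[rotated]) (use secA TS in auto)
      hence "emeasure N ?S = 0 \<or> emeasure N (space N - ?S) = 0"
        by (rule N.ergodic_almost_forward_invariant_set[OF ergT secA])
      thus "measure N ?S = 0 \<or> measure N (space N - ?S) = 0" by (auto simp: measure_def)
    qed
    define C where "C = {x \<in> space N. measure N (Pair x -` A) = 0}"
    have C: "C \<in> sets N"
    proof -
      have "(\<lambda>x. emeasure N (Pair x -` A)) \<in> borel_measurable N"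
        by (rule N.measurable_emeasure_Pair[OF A])
      thus ?thesis unfolding C_def measure_def by measurable
    qed
    have "emeasure N C = 0 \<or> emeasure N (space N - C) = 0"
    proof (rule ergodic_invariant_set[OF ergT C])
      fix x assume x: "x \<in> space N"
      hence xY: "x \<in> Y" by (simp add: space_N)
      have "T -` (Pair (T x) -` A) \<inter> space N = Pair x -` A"
        using inv xY AY by (auto simp: space_N)
      hence "measure N (Pair (T x) -` A) = measure N (Pair x -` A)"
        using measure_preserving_measure[OF mpT secA[of "T x"]] by simp
      thus "T x \<in> C \<longleftrightarrow> x \<in> C" using xY Tsp by (simp add: C_def space_N)
    qed
    thus ?thesis
    proof
      assume "emeasure N C = 0"
      hence "AE x in N. x \<notin> C" using C by (intro AE_not_in) (auto simp: null_sets_def)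
      with dich have full: "AE x in N. emeasure N (Pair x -` (space (N \<Otimes>\<^sub>M N) - A)) = 0"
      proof (rule AE_mp[OF AE_conjI], intro AE_I2 impI)
        fix x assume x: "x \<in> space N" and
          "(measure N (Pair x -` A) = 0 \<or> measure N (space N - Pair x -` A) = 0) \<and> x \<notin> C"
        hence "measure N (space N - Pair x -` A) = 0" by (auto simp: C_def)
        moreover have "Pair x -` (space (N \<Otimes>\<^sub>M N) - A) = space N - Pair x -` A"
          using x by (auto simp: space_pair_measure)
        ultimately show "emeasure N (Pair x -` (space (N \<Otimes>\<^sub>M N) - A)) = 0"
          by (simp add: N.emeasure_eq_measure)
      qed
      have "emeasure (N \<Otimes>\<^sub>M N) (space (N \<Otimes>\<^sub>M N) - A)
          = (\<integral>\<^sup>+x. emeasure N (Pair x -` (space (N \<Otimes>\<^sub>M N) - A)) \<partial>N)"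
        using A by (intro N.emeasure_pair_measure_alt) auto
      also have "\<dots> = (\<integral>\<^sup>+x. 0 \<partial>N)" by (rule nn_integral_cong_AE[OF full])
      finally show ?thesis by simp
    next
      assume "emeasure N (space N - C) = 0"
      hence "AE x in N. x \<notin> space N - C" using C by (intro AE_not_in) (auto simp: null_sets_def)
      hence full: "AE x in N. emeasure N (Pair x -` A) = 0"
        by (rule AE_mp) (auto intro!: AE_I2 simp: C_def N.emeasure_eq_measure)
      have "emeasure (N \<Otimes>\<^sub>M N) A = (\<integral>\<^sup>+x. emeasure N (Pair x -` A) \<partial>N)"
        by (rule N.emeasure_pair_measure_alt[OF A])
      also have "\<dots> = (\<integral>\<^sup>+x. 0 \<partial>N)" by (rule nn_integral_cong_AE[OF full])
      finally show ?thesis by simp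
    qed
  qed
  hence "ergodic (N \<Otimes>\<^sub>M N) ?TT"
    using measure_preserving_map_prod[OF N.sigma_finite_measure_axioms mpT mpT]
    by (simp add: ergodic_def)
  hence "weakly_mixing N T" by (rule N.weakly_mixing_if_square_ergodic[OF mpT])
  thus ?thesis by (simp add: N_def T_def Y_def)
qed

section \<open>Category and measure of the weakly mixing parameters\<close>

text \<open>
  A relatively open nonempty subset of \<open>[0, b)\<close> contains an interval, which has positive measure.
\<close>

lemma nowhere_dense_in_conull_open_compl:
  assumes G: "open G" and null: "emeasure L (X - G) = 0" and S: "S \<subseteq> X - G"
  shows "nowhere_dense_in (top_of_set X) S"
proof -
  have "closedin (top_of_set X) (X - G)"
    using G by (auto simp: closedin_closed intro!: exI[of _ "- G"])
  hence "top_of_set X closure_of S \<subseteq> X - G" using S by (rule closure_of_minimal[rotated])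
  hence "top_of_set X interior_of (top_of_set X closure_of S) \<subseteq> top_of_set X interior_of (X - G)"
    by (rule interior_of_mono)
  also have "\<dots> = {}"
  proof (rule ccontr)
    assume "top_of_set X interior_of (X - G) \<noteq> {}"
    then obtain x U where U: "openin (top_of_set X) U" "x \<in> U" "U \<subseteq> X - G"
      by (auto simp: interior_of_def)
    then obtain V where V: "open V" "U = X \<inter> V" by (auto simp: openin_open)
    have x: "x \<in> X" "x \<in> V" using U V by auto
    then obtain r where r: "r > 0" "ball x r \<subseteq> V" using V(1) openE by blast
    define y where "y = min (x + r) b"
    have xy: "x < y" using x r by (auto simp: y_def)
    have sub: "{x<..<y} \<subseteq> X - G"
    proof -
      have "{x<..<y} \<subseteq> X" using x by (auto simp: y_def)
      moreover have "{x<..<y} \<subseteq> ball x r" by (auto simp: y_def dist_real_def)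
      ultimately show ?thesis using r(2) U(3) V(2) by blast
    qed
    have "X - G \<in> sets L" using G by (auto simp: sets_L_iff)
    hence "measure L {x<..<y} \<le> measure L (X - G)" using sub by (intro finite_measure_mono)
    moreover have "measure L {x<..<y} = y - x" using xy sub by (intro measure_L_Ioo) auto
    ultimately show False using xy null by (simp add: measure_def)
  qed
  finally show ?thesis using S by (auto simp: nowhere_dense_in_def)
qed

lemma tower_sequence:
  obtains u v :: "nat \<Rightarrow> real" and h :: "nat \<Rightarrow> nat" and s :: "nat \<Rightarrow> nat \<Rightarrow> real" where
    "\<And>n. tower (u n) (v n) (h n) (s n)" "\<And>n. v n - u n \<le> b * (1 / 2) ^ n"
    "\<And>n. b / real (card D + 2) \<le> real (h n) * (v n - u n)"
proof -
  have "\<exists>u v h s. tower u v h s \<and> v - u \<le> b * (1 / 2) ^ n \<and> b / real (card D + 2) \<le> real h * (v - u)" for n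
    using b_pos by (intro large_tower_exists) (auto simp: power_le_one mult_left_le)
  then obtain u v h s where "\<forall>n. tower (u n) (v n) (h n) (s n) \<and> v n - u n \<le> b * (1 / 2) ^ n \<and>
      b / real (card D + 2) \<le> real (h n) * (v n - u n)" by metis
  thus ?thesis using that[of u v h s] by blast
qed

lemma residual_and_full_measure_X_wm:
  "residual_in (top_of_set X) (X_wm b f)"
  "X_wm b f \<in> sets lebesgue" "emeasure lebesgue (X_wm b f) = ennreal b"
proof -
  obtain u v :: "nat \<Rightarrow> real" and h s where tow: "\<And>n. tower (u n) (v n) (h n) (s n)"
    and small: "\<And>n. v n - u n \<le> b * (1 / 2) ^ n"
    and large: "\<And>n. b / real (card D + 2) \<le> real (h n) * (v n - u n)"
    by (rule tower_sequence) blast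
  have c0: "b / real (card D + 2) > 0" using b_pos by simp
  define C where "C n = core (u n) (v n) (h n) (s n)" for n
  define G where "G N = (\<Union>n\<in>{N..}. C n)" for N
  have wm: "t \<in> X_wm b f" if t: "t \<in> (\<Inter>N. G N)" for t
  proof -
    obtain n where "t \<in> C n" using t by (auto simp: G_def)
    moreover have "C n \<subseteq> interior X"
      unfolding C_def by (rule interior_maximal[OF core_subset_X[OF tow] open_core])
    ultimately have "0 < t" "t < b" by auto
    moreover have "t \<in> (\<Inter>N. \<Union>n\<in>{N..}. core (u n) (v n) (h n) (s n))"
      using t by (simp add: G_def C_def)
    ultimately show ?thesis
      using weakly_mixing_first_return_map[OF _ _ tow small large c0] by (simp add: X_wm_def)
  qed
  have null: "emeasure L (X - (\<Inter>N. G N)) = 0"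
    using limsup_core_conull[OF tow small large c0] by (simp add: G_def C_def)
  have G: "open (G N)" for N unfolding G_def C_def by (intro open_UN ballI open_core)
  have Gs: "X - G N \<in> sets L" for N using G[of N] by (auto simp: sets_L_iff)
  have Hs: "X - (\<Inter>N. G N) \<in> sets L"
  proof -
    have "X - (\<Inter>N. G N) = (\<Union>N. X - G N)" by blast
    thus ?thesis using Gs by (simp only:) (intro sets.countable_UN, auto)
  qed
  have sub: "X_wm b f \<subseteq> X" by (auto simp: X_wm_def)
  have "nowhere_dense_in (top_of_set X) ((X - X_wm b f) - G N)" for N
  proof (rule nowhere_dense_in_conull_open_compl[OF G])
    show "emeasure L (X - G N) = 0" by (rule emeasure_eq_0[OF Hs null]) auto
  qed auto
  moreover have "X - X_wm b f = (\<Union>N. (X - X_wm b f) - G N)" using wm by blast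
  ultimately have "meager_in (top_of_set X) (X - X_wm b f)"
    unfolding meager_in_def
    by (intro exI[of _ "range (\<lambda>N. (X - X_wm b f) - G N)"]) auto
  thus "residual_in (top_of_set X) (X_wm b f)" using sub by (simp add: residual_in_def)
  have "X - (\<Inter>N. G N) \<in> null_sets lebesgue"
    using null Hs by (auto simp: null_sets_def emeasure_L sets_L_iff)
  hence N: "X - X_wm b f \<in> null_sets lebesgue"
    by (rule null_sets_completion_subset[rotated]) (use wm in blast)
  have eq: "X_wm b f = X - (X - X_wm b f)" using sub by blast
  have "X - (X - X_wm b f) \<in> sets lebesgue" using N by auto
  thus "X_wm b f \<in> sets lebesgue" using eq by simp
  have "emeasure lebesgue (X - (X - X_wm b f)) = emeasure lebesgue X"
    by (rule emeasure_Diff_null_set[OF N]) simp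
  thus "emeasure lebesgue (X_wm b f) = ennreal b"
    using eq b_pos by (metis emeasure_L emeasure_L_X order_refl)
qed

end

theorem theorem1:
  fixes b :: real and f :: "real \<Rightarrow> real"
  assumes "iet b f"
    and "ergodic (lebesgue_on {0..<b}) f"
  shows "residual_in (top_of_set {0..<b}) (X_wm b f) \<and>
         X_wm b f \<in> sets lebesgue \<and>
         emeasure lebesgue (X_wm b f) = ennreal b"
proof -
  interpret ergodic_iet b f by unfold_locales (fact assms)+
  show ?thesis using residual_and_full_measure_X_wm by blast
qed

end
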